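(* Let $\mathcal{H}$ be a Hilbert space with inner product $\langle\cdot,\cdot\rangle$, let $\mathcal{K}$ be an isometry of $\mathcal{H}$, and let $f\in\mathcal{H}$ be any vector. Let $$C_N(f)=\begin{pmatrix}\langle f,f\rangle & \langle f,\mathcal{K}f\rangle & \cdots & \langle f,\mathcal{K}^Nf\rangle\\ \langle \mathcal{K}f,f\rangle & \langle \mathcal{K}f,\mathcal{K}f\rangle & \cdots & \langle \mathcal{K}f,\mathcal{K}^Nf\rangle\\ \vdots & & & \vdots\\ \langle \mathcal{K}^Nf,f\rangle & \langle \mathcal{K}^Nf,\mathcal{K}f\rangle & \cdots & \langle \mathcal{K}^Nf,\mathcal{K}^Nf\rangle\end{pmatrix}.$$ Let $v_i$ be the eigenvectors (of unit length) of $\mathcal{K}$ in $\mathcal{H}$, and let $$f=\sum_i a_iv_i+f^{\perp}$$ be the decomposition of $f$, where $f^{\perp}$ is perpendicular to the subspace spanned by all the eigenvectors of $\mathcal{K}$. Let $d_{N,1}\ge d_{N,2}\ge\cdots\ge 0$ be the eigenvalues of $C_N(f)$, and assume that $|a_1|\ge|a_2|\ge\cdots\ge 0$. Then $$\lim_{N\to\infty}\frac{d_{N,i}}{N}=|a_i|^2$$ (for each $i$).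
   Context: $\mathcal{H}$ is a complex Hilbert space. $C_N(f)$ is the $(N+1)\times(N+1)$ matrix whose $(j,k)$ entry, $0\le j,k\le N$, is $\langle\mathcal{K}^jf,\mathcal{K}^kf\rangle$. There may be uncountably many eigenvectors $v_i$ of $\mathcal{K}$ in $\mathcal{H}$, but only countably many are included in the sum $\sum_i a_iv_i$.
   Formalization: The v_i in the sum are taken to belong to pairwise distinct eigenvalues (one unit eigenvector per eigenvalue, along the projection of f onto that eigenspace); with repeated eigenvalues the claim fails, e.g. K = identity, f = e_1 + e_2 gives limits 2, 0. *)

theory Defs
  imports "HOL-Analysis.Infinite_Sum" "Jordan_Normal_Form.Char_Poly"
begin

class complex_vector = real_vector +
  fixes scaleC :: "complex \<Rightarrow> 'a \<Rightarrow> 'a" (infixr "*\<^sub>C" 75)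
  assumes scaleC_add_right: "c *\<^sub>C (x + y) = c *\<^sub>C x + c *\<^sub>C y"
    and scaleC_add_left: "(c + d) *\<^sub>C x = c *\<^sub>C x + d *\<^sub>C x"
    and scaleC_scaleC: "c *\<^sub>C d *\<^sub>C x = (c * d) *\<^sub>C x"
    and scaleC_one: "1 *\<^sub>C x = x"
    and scaleR_scaleC: "r *\<^sub>R x = complex_of_real r *\<^sub>C x"

global_interpretation complex_vector: vector_space "scaleC :: complex \<Rightarrow> 'a \<Rightarrow> 'a::complex_vector"
  by unfold_locales (simp_all add: scaleC_add_right scaleC_add_left scaleC_scaleC scaleC_one)

(* The inner product is linear in its first argument and conjugate-linear in the second.
   A Hermitian matrix and its transpose have the same eigenvalues, so the opposite
   convention would give the same Gram matrix eigenvalues. *)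
class complex_inner = complex_vector + real_normed_vector +
  fixes cinner :: "'a \<Rightarrow> 'a \<Rightarrow> complex"
  assumes cinner_commute: "cinner x y = cnj (cinner y x)"
    and cinner_add_left: "cinner (x + y) z = cinner x z + cinner y z"
    and cinner_scaleC_left: "cinner (c *\<^sub>C x) y = c * cinner x y"
    and cinner_ge_zero: "0 \<le> Re (cinner x x)"
    and cinner_eq_zero_iff: "cinner x x = 0 \<longleftrightarrow> x = 0"
    and norm_eq_sqrt_cinner: "norm x = sqrt (Re (cinner x x))"

class complex_hilbert_space = complex_inner + complete_space

definition linear_isometry :: "('a::complex_hilbert_space \<Rightarrow> 'a) \<Rightarrow> bool" where
  "linear_isometry K \<longleftrightarrow> Vector_Spaces.linear (*\<^sub>C) (*\<^sub>C) K \<and> (\<forall>x. norm (K x) = norm x)"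

definition is_eigenvector :: "('a::complex_hilbert_space \<Rightarrow> 'a) \<Rightarrow> complex \<Rightarrow> 'a \<Rightarrow> bool" where
  "is_eigenvector K z v \<longleftrightarrow> v \<noteq> 0 \<and> K v = z *\<^sub>C v"

definition eigenvectors :: "('a::complex_hilbert_space \<Rightarrow> 'a) \<Rightarrow> 'a set" where
  "eigenvectors K = {v. \<exists>z. is_eigenvector K z v}"

(* The decomposition f = (\<Sum>i. a i *\<^sub>C v i) + g along unit eigenvectors v i of K, indexed from 1.
   The index set I is an initial segment of the positive integers, finite or not, and a is
   extended by zero outside I, so that a i makes sense for every i \<ge> 1.
   One eigenvector is used per eigenvalue (inj_on), namely the direction of the projection of f
   onto that eigenspace. Several v i sharing an eigenvalue must be excluded: for K the identity
   and f = e1 + e2 with e1, e2 orthonormal, the Gram matrices have rank one, and the largest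
   eigenvalue grows like 2 * N. *)
definition eigen_decomposition ::
  "('a::complex_hilbert_space \<Rightarrow> 'a) \<Rightarrow> 'a \<Rightarrow> nat set \<Rightarrow>
    (nat \<Rightarrow> complex) \<Rightarrow> (nat \<Rightarrow> 'a) \<Rightarrow> (nat \<Rightarrow> complex) \<Rightarrow> 'a \<Rightarrow> bool" where
  "eigen_decomposition K f I z v a g \<longleftrightarrow>
     (I = {1..} \<or> (\<exists>m. I = {1..m})) \<and>
     (\<forall>i\<in>I. is_eigenvector K (z i) (v i) \<and> norm (v i) = 1) \<and>
     inj_on z I \<and>
     (\<forall>i. i \<notin> I \<longrightarrow> a i = 0) \<and>
     (\<exists>s. ((\<lambda>i. a i *\<^sub>C v i) has_sum s) I \<and> f = s + g) \<and>
     (\<forall>w \<in> complex_vector.span (eigenvectors K). cinner g w = 0)"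

definition gram_mat :: "('a::complex_hilbert_space \<Rightarrow> 'a) \<Rightarrow> 'a \<Rightarrow> nat \<Rightarrow> complex mat" where
  "gram_mat K f N = Matrix.mat (N + 1) (N + 1) (\<lambda>(j, k). cinner ((K ^^ j) f) ((K ^^ k) f))"

(* d 1 \<ge> \<dots> \<ge> d n are the eigenvalues of the n x n matrix A, all real, listed with multiplicity.
   Values of d outside {1..n} are irrelevant. For a Gram matrix, nonnegativity of the d i is
   automatic and need not be required. *)
definition ordered_eigenvalues :: "complex mat \<Rightarrow> (nat \<Rightarrow> real) \<Rightarrow> bool" where
  "ordered_eigenvalues A d \<longleftrightarrow>
     char_poly A = (\<Prod>i\<in>{1..dim_row A}. [:- complex_of_real (d i), 1:]) \<and>
     antimono_on {1..dim_row A} d"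

end

theory Submission
  imports Defs "HOL-Analysis.Topology_Euclidean_Space" "HOL-Analysis.Convex"
    "Jordan_Normal_Form.Schur_Decomposition"
begin

text \<open>
  Put \<open>n = N + 1\<close>. The quadratic form of the Gram matrix at \<open>x \<in> \<complex>\<^sup>n\<close> is the squared norm of
  \<open>\<Sum>\<^sub>p cnj x\<^sub>p K\<^sup>p f\<close>. Eigenvectors of an isometry for distinct eigenvalues are orthogonal and the
  eigenvalues \<open>z\<^sub>l\<close> have modulus one, so with \<open>f = \<Sum>\<^sub>l a\<^sub>l v\<^sub>l + h\<close>, the sum running over a finite
  set and \<open>h\<close> being orthogonal to its members, the form equals
  \<open>\<Sum>\<^sub>l \<bar>a\<^sub>l\<bar>\<^sup>2 \<bar>\<langle>x, e\<^sub>l\<rangle>\<bar>\<^sup>2 + \<parallel>\<Sum>\<^sub>p cnj x\<^sub>p K\<^sup>p h\<parallel>\<^sup>2\<close>, where \<open>e\<^sub>l = (z\<^sub>l\<^sup>p)\<^sub>p\<close>.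
  The vectors \<open>e\<^sub>l\<close> have squared norm \<open>n\<close> and pairwise inner products bounded independently of \<open>n\<close>.
  If the second term were absent, the form would be close to \<open>n\<close> times a form with eigenvalues
  \<open>\<bar>a\<^sub>l\<bar>\<^sup>2\<close>, and the minimax principle would give the limit.

  The point is thus that the remainder \<open>h\<close> contributes at most \<open>\<epsilon> n\<close> times the squared norm of
  \<open>x\<close> (\<open>eigen_decomposition_truncate\<close>). Usually this is read off from the spectral measure
  of \<open>h\<close>, which has only small atoms. Here it is obtained without spectral measures, in two steps.
  By the mean ergodic theorem for the isometries \<open>c K\<close> and compactness of the circle, the sums
  \<open>\<Sum>k<n. c\<^sup>k K\<^sup>k g\<close> are \<open>o(n)\<close> uniformly in \<open>\<bar>c\<bar> = 1\<close> when \<open>g\<close> is orthogonal to all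
  eigenvectors (\<open>uniform_rotated_orbit_means\<close>). A Fourier argument over roots of unity then passes
  from the coefficients \<open>c\<^sup>k\<close> to arbitrary ones (\<open>norm_orbit_combination_le\<close>).

  On the matrix side, the two inequalities of Courant and Fischer (\<open>ordered_eigenvalue_le\<close> and
  \<open>ordered_eigenvalue_ge\<close>) need an orthonormal eigenbasis listed in the given order of the
  eigenvalues (\<open>ordered_eigenbasis\<close>).
\<close>

section \<open>Complex inner products\<close>

lemma cinner_zero_left [simp]: "cinner 0 (y::'a::complex_inner) = 0"
  using cinner_scaleC_left[of 0 0 y] by simp

lemma cinner_zero_right [simp]: "cinner (x::'a::complex_inner) 0 = 0"
  using cinner_commute[of x 0] by simp

lemma cinner_add_right: "cinner (x::'a::complex_inner) (y + z) = cinner x y + cinner x z"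
  by (metis cinner_add_left cinner_commute complex_cnj_add)

lemma cinner_scaleC_right: "cinner (x::'a::complex_inner) (c *\<^sub>C y) = cnj c * cinner x y"
  by (metis cinner_commute cinner_scaleC_left complex_cnj_mult)

lemma cinner_diff_left: "cinner (x - y) (z::'a::complex_inner) = cinner x z - cinner y z"
  by (metis add_diff_cancel cinner_add_left diff_add_cancel)

lemma cinner_diff_right: "cinner z (x - y :: 'a::complex_inner) = cinner z x - cinner z y"
  by (metis add_diff_cancel cinner_add_right diff_add_cancel)

lemma cinner_sum_left: "cinner (sum f A) (y::'a::complex_inner) = (\<Sum>i\<in>A. cinner (f i) y)"
  by (induction A rule: infinite_finite_induct) (simp_all add: cinner_add_left)

lemma cinner_sum_right: "cinner (y::'a::complex_inner) (sum f A) = (\<Sum>i\<in>A. cinner y (f i))"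
  by (induction A rule: infinite_finite_induct) (simp_all add: cinner_add_right)

lemma cinner_self: "cinner x x = complex_of_real ((norm (x::'a::complex_inner))\<^sup>2)"
proof -
  have "Im (cinner x x) = 0"
    using cinner_commute[of x x] by (simp add: complex_eq_iff)
  then show ?thesis
    using cinner_ge_zero[of x] by (simp add: complex_eq_iff norm_eq_sqrt_cinner)
qed

lemma norm_scaleC: "norm (c *\<^sub>C (x::'a::complex_inner)) = cmod c * norm x"
proof -
  have "complex_of_real ((norm (c *\<^sub>C x))\<^sup>2) = complex_of_real ((cmod c * norm x)\<^sup>2)"
    unfolding cinner_self[symmetric] cinner_scaleC_left cinner_scaleC_right
    by (simp add: cinner_self power_mult_distrib complex_norm_square del: of_real_power)
  then show ?thesis
    by (simp only: of_real_eq_iff) (simp add: power2_eq_iff_nonneg)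
qed

lemma norm_add_squared:
  "(norm (x + y :: 'a::complex_inner))\<^sup>2 = (norm x)\<^sup>2 + (norm y)\<^sup>2 + 2 * Re (cinner x y)"
proof -
  have "complex_of_real ((norm (x + y))\<^sup>2)
      = complex_of_real ((norm x)\<^sup>2 + (norm y)\<^sup>2) + (cinner x y + cnj (cinner x y))"
    unfolding cinner_self[symmetric] cinner_add_left cinner_add_right
    using cinner_commute[of y x] by (simp add: cinner_self)
  also have "\<dots> = complex_of_real ((norm x)\<^sup>2 + (norm y)\<^sup>2 + 2 * Re (cinner x y))"
    by (simp add: complex_add_cnj)
  finally show ?thesis by (simp only: of_real_eq_iff)
qed

lemma parallelogram_law:
  "(norm (x + y :: 'a::complex_inner))\<^sup>2 + (norm (x - y))\<^sup>2 = 2 * (norm x)\<^sup>2 + 2 * (norm y)\<^sup>2"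
proof -
  have "cinner x (- y) = - cinner x y"
    using cinner_diff_right[of x 0 y] by simp
  then show ?thesis
    using norm_add_squared[of x y] norm_add_squared[of x "- y"] by simp
qed

text \<open>Rotating \<open>x\<close> by the phase \<open>c\<close> makes \<open>\<langle>c x, y\<rangle>\<close> the nonnegative real \<open>\<bar>\<langle>x, y\<rangle>\<bar>\<close>; the
  triangle inequality for the norm then gives the bound.\<close>

lemma cinner_Cauchy_Schwarz: "cmod (cinner x y) \<le> norm (x::'a::complex_inner) * norm y"
proof (cases "cinner x y = 0")
  case False
  define c where "c = cnj (sgn (cinner x y))"
  have c: "cmod c = 1"
    using False by (simp add: c_def norm_sgn)
  have "cinner (c *\<^sub>C x) y = complex_of_real (cmod (cinner x y))"
    using False unfolding cinner_scaleC_left c_def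
    by (simp add: sgn_eq) (metis complex_norm_square mult.commute nonzero_mult_div_cancel_right
        norm_eq_zero of_real_eq_0_iff of_real_power power2_eq_square)
  moreover have "(norm (c *\<^sub>C x + y))\<^sup>2 \<le> (norm (c *\<^sub>C x) + norm y)\<^sup>2"
    by (intro power_mono norm_triangle_ineq) simp
  ultimately show ?thesis
    unfolding norm_add_squared by (simp add: power2_sum norm_scaleC c)
qed simp

lemma norm_sum_orthogonal:
  fixes u :: "'b \<Rightarrow> 'a::complex_inner"
  assumes "finite A" "\<And>i j. i \<in> A \<Longrightarrow> j \<in> A \<Longrightarrow> i \<noteq> j \<Longrightarrow> cinner (u i) (u j) = 0"
  shows "(norm (\<Sum>i\<in>A. u i))\<^sup>2 = (\<Sum>i\<in>A. (norm (u i))\<^sup>2)"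
  using assms
proof (induction A rule: finite_induct)
  case (insert i A)
  have "cinner (u i) (sum u A) = 0"
    using insert.hyps insert.prems by (auto simp: cinner_sum_right intro!: sum.neutral)
  with insert show ?case by (simp add: norm_add_squared)
qed simp

section \<open>Isometries and their mean ergodic theorem\<close>

lemma linear_isometryI:
  fixes K :: "'a::complex_hilbert_space \<Rightarrow> 'a"
  assumes "\<And>x y. K (x + y) = K x + K y" "\<And>c x. K (c *\<^sub>C x) = c *\<^sub>C K x"
    "\<And>x. norm (K x) = norm x"
  shows "linear_isometry K"
  unfolding linear_isometry_def using assms
  by (auto intro!: Vector_Spaces.linear.intro module_hom.intro module_hom_axioms.intro
      complex_vector.module_axioms complex_vector.vector_space_axioms)

definition orbit_sum :: "('a::complex_hilbert_space \<Rightarrow> 'a) \<Rightarrow> nat \<Rightarrow> 'a \<Rightarrow> 'a" where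
  "orbit_sum K n x = (\<Sum>k<n. (K ^^ k) x)"

locale isometry =
  fixes K :: "'a::complex_hilbert_space \<Rightarrow> 'a"
  assumes iso: "linear_isometry K"
begin

lemma isometry_norm [simp]: "norm (K x) = norm x"
  using iso by (simp add: linear_isometry_def)

lemma isometry_add: "K (x + y) = K x + K y"
  and isometry_scaleC: "K (c *\<^sub>C x) = c *\<^sub>C K x"
proof -
  interpret Vector_Spaces.linear "(*\<^sub>C)" "(*\<^sub>C)" K
    using iso by (simp add: linear_isometry_def)
  show "K (x + y) = K x + K y" "K (c *\<^sub>C x) = c *\<^sub>C K x"
    by (rule add, rule scale)
qed

lemma isometry_zero [simp]: "K 0 = 0"
  using isometry_scaleC[of 0 0] by simp

lemma isometry_scaleR: "K (r *\<^sub>R x) = r *\<^sub>R K x"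
  by (simp add: scaleR_scaleC isometry_scaleC)

lemma isometry_diff: "K (x - y) = K x - K y"
  by (metis add_diff_cancel isometry_add diff_add_cancel)

lemma isometry_sum: "K (sum u A) = (\<Sum>i\<in>A. K (u i))"
  by (induction A rule: infinite_finite_induct) (simp_all add: isometry_add)

lemma isometry_cinner [simp]: "cinner (K x) (K y) = cinner x y"
proof -
  have Re: "Re (cinner (K x) (K y)) = Re (cinner x y)" for x y
    using norm_add_squared[of "K x" "K y"] norm_add_squared[of x y]
      isometry_norm[of "x + y"] by (simp add: isometry_add)
  have "Im (cinner (K x) (K y)) = Im (cinner x y)"
    using Re[of x "\<i> *\<^sub>C y"] by (simp add: isometry_scaleC cinner_scaleC_right)
  with Re show ?thesis by (simp add: complex_eq_iff)
qed

lemma isometry_funpow: "isometry (K ^^ n)"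
proof (intro isometry.intro linear_isometryI)
  show "(K ^^ n) (x + y) = (K ^^ n) x + (K ^^ n) y" for x y
    by (induction n) (simp_all add: isometry_add)
  show "(K ^^ n) (c *\<^sub>C x) = c *\<^sub>C (K ^^ n) x" for c x
    by (induction n) (simp_all add: isometry_scaleC)
  show "norm ((K ^^ n) x) = norm x" for x
    by (induction n) simp_all
qed

lemmas iterate_norm [simp] = isometry.isometry_norm [OF isometry_funpow]
  and iterate_add = isometry.isometry_add [OF isometry_funpow]
  and iterate_scaleC = isometry.isometry_scaleC [OF isometry_funpow]
  and iterate_scaleR = isometry.isometry_scaleR [OF isometry_funpow]
  and iterate_sum = isometry.isometry_sum [OF isometry_funpow]
  and iterate_cinner [simp] = isometry.isometry_cinner [OF isometry_funpow]

lemma isometry_rotate: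
  assumes "cmod c = 1"
  shows "isometry (\<lambda>x. c *\<^sub>C K x)"
  using assms by (intro isometry.intro linear_isometryI)
    (simp_all add: isometry_add isometry_scaleC norm_scaleC scaleC_add_right scaleC_scaleC mult.commute)

lemma funpow_rotate: "((\<lambda>x. c *\<^sub>C K x) ^^ n) x = (c ^ n) *\<^sub>C (K ^^ n) x"
  by (induction n) (simp_all add: isometry_scaleC scaleC_scaleC)

lemma norm_orbit_sum_le: "norm (orbit_sum K n x) \<le> real n * norm x"
proof -
  have "norm (orbit_sum K n x) \<le> (\<Sum>k<n. norm ((K ^^ k) x))"
    unfolding orbit_sum_def by (rule norm_sum)
  also have "\<dots> = real n * norm x"
    using iterate_norm by simp
  finally show ?thesis .
qed

lemma orbit_sum_scaleR: "orbit_sum K n (r *\<^sub>R x) = r *\<^sub>R orbit_sum K n x"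
  and orbit_sum_add: "orbit_sum K n (x + y) = orbit_sum K n x + orbit_sum K n y"
  unfolding orbit_sum_def
  by (simp_all add: iterate_scaleR scaleR_sum_right
      iterate_add sum.distrib)

text \<open>The differences \<open>K S - S\<close> telescope to \<open>K\<^sup>n x - x\<close>, so a shift by \<open>k\<close> costs an amount that does not
  grow with \<open>n\<close>.\<close>

lemma norm_shift_orbit_sum_le:
  "norm ((K ^^ k) (orbit_sum K n x) - orbit_sum K n x) \<le> 2 * real k * norm x"
proof (induction k)
  case (Suc k)
  let ?S = "orbit_sum K n x"
  have "K ?S - ?S = (\<Sum>k<n. (K ^^ Suc k) x - (K ^^ k) x)"
    by (simp add: orbit_sum_def isometry_sum sum_subtractf)
  also have "\<dots> = (K ^^ n) x - x"
    by (subst sum_lessThan_telescope) simp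
  finally have "norm (K ?S - ?S) \<le> 2 * norm x"
    using norm_triangle_ineq4[of "(K ^^ n) x" x] iterate_norm[of n x]
    by simp
  moreover have "(K ^^ Suc k) ?S - ?S = K ((K ^^ k) ?S - ?S) + (K ?S - ?S)"
    by (simp add: isometry_diff)
  ultimately show ?case
    using Suc norm_triangle_ineq[of "K ((K ^^ k) ?S - ?S)" "K ?S - ?S"]
    by (simp add: algebra_simps)
qed simp

text \<open>Averaging an average again changes long averages only by a bounded amount: the double sum
  consists of \<open>m\<close> shifted copies of the orbit sum of length \<open>n\<close>.\<close>

lemma norm_orbit_sum_orbit_sum_le:
  "norm (orbit_sum K n (orbit_sum K m x) - real m *\<^sub>R orbit_sum K n x) \<le> 2 * (real m)\<^sup>2 * norm x"
proof -
  have "orbit_sum K n (orbit_sum K m x) = (\<Sum>j<n. \<Sum>k<m. (K ^^ k) ((K ^^ j) x))"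
    unfolding orbit_sum_def
    by (simp add: iterate_sum add.commute flip: comp_apply[of "K ^^ _" "K ^^ _"] funpow_add)
  also have "\<dots> = (\<Sum>k<m. (K ^^ k) (orbit_sum K n x))"
    unfolding orbit_sum_def
    by (subst sum.swap) (simp add: iterate_sum)
  finally have "orbit_sum K n (orbit_sum K m x) - real m *\<^sub>R orbit_sum K n x
      = (\<Sum>k<m. (K ^^ k) (orbit_sum K n x) - orbit_sum K n x)"
    by (simp add: sum_subtractf sum_constant_scaleR)
  also have "norm \<dots> \<le> (\<Sum>k<m. 2 * real m * norm x)"
  proof (rule sum_norm_le)
    fix k assume "k \<in> {..<m}"
    then have "2 * real k * norm x \<le> 2 * real m * norm x"
      by (intro mult_right_mono) auto
    then show "norm ((K ^^ k) (orbit_sum K n x) - orbit_sum K n x) \<le> 2 * real m * norm x"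
      using norm_shift_orbit_sum_le[of k n x] by linarith
  qed
  finally show ?thesis by (simp add: power2_eq_square)
qed

text \<open>Up to an error that vanishes as \<open>n\<close> grows, no mean over \<open>n\<close> iterates is longer than a given mean
  over \<open>m\<close> iterates. Hence the norms of the means converge to their infimum; the explicit error
  term also makes the later uniform statement over the circle possible.\<close>

lemma norm_orbit_mean_le:
  assumes "m > 0" "n > 0"
  shows "norm (orbit_sum K n x) / real n
      \<le> norm (orbit_sum K m x) / real m + 2 * real m * norm x / real n"
proof -
  have "real m * norm (orbit_sum K n x) = norm (real m *\<^sub>R orbit_sum K n x)" by simp
  also have "\<dots> \<le> norm (orbit_sum K n (orbit_sum K m x)) + 2 * (real m)\<^sup>2 * norm x"
    using norm_orbit_sum_orbit_sum_le[of n m x]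
      norm_triangle_ineq2[of "real m *\<^sub>R orbit_sum K n x" "orbit_sum K n (orbit_sum K m x)"]
    by (simp add: norm_minus_commute)
  also have "\<dots> \<le> real n * norm (orbit_sum K m x) + 2 * (real m)\<^sup>2 * norm x"
    using norm_orbit_sum_le by simp
  finally show ?thesis
    using assms by (simp add: field_simps power2_eq_square)
qed

text \<open>Von Neumann's theorem without orthogonal projections. Let \<open>\<delta>\<close> be the infimum of the norms of the
  means. The midpoint of two means still has norm at least \<open>\<delta>\<close>, because averaging it over a long
  orbit segment brings it back close to a mean. Since the means themselves have norm close to \<open>\<delta>\<close>,
  the parallelogram law makes them a Cauchy sequence.\<close>

lemma mean_ergodic:
  obtains p where "K p = p" "(\<lambda>n. orbit_sum K n x /\<^sub>R real n) \<longlonglongrightarrow> p"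
proof -
  define A where "A n = orbit_sum K n x /\<^sub>R real n" for n
  \<comment> \<open>The index \<open>0\<close> is left out because \<open>A 0 = 0\<close> by the convention for division by zero.\<close>
  define \<delta> where "\<delta> = (INF n\<in>{0<..}. norm (A n))"
  have norm_A: "norm (A n) = norm (orbit_sum K n x) / real n" for n
    by (simp add: A_def divide_inverse mult.commute)
  have bdd: "bdd_below ((\<lambda>n. norm (A n)) ` {0<..})"
    by (rule bdd_belowI2[where m = 0]) simp
  have \<delta>_le: "\<delta> \<le> norm (A n)" if "n > 0" for n
    unfolding \<delta>_def by (rule cINF_lower[OF bdd]) (use that in simp)
  have \<delta>_nonneg: "0 \<le> \<delta>"
    unfolding \<delta>_def by (rule cINF_greatest) auto
  have half: "2 * \<delta> \<le> norm (A n + A m)" if "n > 0" "m > 0" for n m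
  proof (rule field_le_epsilon)
    fix e :: real assume "e > 0"
    obtain L :: nat where L: "L > 0" "2 * real (n + m) * norm x / e < real L"
      by (metis gr0I not_less of_nat_0_less_iff order.strict_trans reals_Archimedean2 of_nat_le_iff
          linorder_not_le order_le_less_trans of_nat_0_le_iff)
    let ?O = "orbit_sum K L"
    \<comment> \<open>Long averages of \<open>A k\<close> and of \<open>x\<close> agree up to a bounded error.\<close>
    have close: "norm (?O (A k) - ?O x) \<le> 2 * real k * norm x" if "k > 0" for k
    proof -
      have "?O (A k) - ?O x = (?O (orbit_sum K k x) - real k *\<^sub>R ?O x) /\<^sub>R real k"
        using that by (simp add: A_def orbit_sum_scaleR scaleR_diff_right)
      then have "norm (?O (A k) - ?O x) * real k = norm (?O (orbit_sum K k x) - real k *\<^sub>R ?O x)"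
        using that by simp
      also have "\<dots> \<le> (2 * real k * norm x) * real k"
        using norm_orbit_sum_orbit_sum_le[of L k x] by (simp add: power2_eq_square algebra_simps)
      finally show ?thesis
        using that by (simp only: mult_le_cancel_right_pos of_nat_0_less_iff)
    qed
    have "2 * \<delta> * real L \<le> norm (2 *\<^sub>R ?O x)"
      using \<delta>_le[OF L(1)] L(1) by (simp add: norm_A field_simps)
    also have "2 *\<^sub>R ?O x = ?O (A n + A m) - ((?O (A n) - ?O x) + (?O (A m) - ?O x))"
      by (simp add: orbit_sum_add scaleR_2)
    also have "norm \<dots> \<le> norm (?O (A n + A m)) + (2 * real n * norm x + 2 * real m * norm x)"
      by (intro order_trans[OF norm_triangle_ineq4] add_mono order_refl
          order_trans[OF norm_triangle_ineq] close that)
    also have "\<dots> \<le> real L * norm (A n + A m) + 2 * real (n + m) * norm x"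
      using norm_orbit_sum_le[of L "A n + A m"] by (simp add: algebra_simps)
    also have "\<dots> \<le> real L * norm (A n + A m) + e * real L"
      using L(2) \<open>e > 0\<close> by (simp add: field_simps)
    finally have "real L * (2 * \<delta>) \<le> real L * (norm (A n + A m) + e)"
      by (simp add: algebra_simps)
    then show "2 * \<delta> \<le> norm (A n + A m) + e"
      using L(1) by simp
  qed
  have near: "\<exists>N>0. \<forall>n\<ge>N. norm (A n) < \<delta> + e" if "e > 0" for e
  proof -
    have "\<delta> < \<delta> + e / 2" using that by simp
    then obtain m where m: "m > 0" "norm (A m) < \<delta> + e / 2"
      using cINF_less_iff[OF _ bdd, of "\<delta> + e / 2"] unfolding \<delta>_def[symmetric] by auto
    obtain N :: nat where N: "4 * real m * norm x / e < real N"
      using reals_Archimedean2 by blast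
    have "norm (A n) < \<delta> + e" if "n \<ge> Suc N" for n
    proof -
      have "4 * real m * norm x / e < real n" using N that by linarith
      then have "2 * real m * norm x / real n < e / 2"
        using \<open>e > 0\<close> that by (simp add: field_simps)
      then show ?thesis
        using norm_orbit_mean_le[of m n x] m that unfolding norm_A by simp
    qed
    then show ?thesis by blast
  qed
  have "Cauchy A"
  proof (rule metric_CauchyI)
    fix e :: real assume "e > 0"
    \<comment> \<open>Any \<open>h\<close> with \<open>4 (2 \<delta> h + h\<^sup>2) < e\<^sup>2\<close> works in the parallelogram law below.\<close>
    define h where "h = min 1 (e\<^sup>2 / (4 * (2 * \<delta> + 1) + 1))"
    have h: "h > 0" "h \<le> 1"
      using \<open>e > 0\<close> \<delta>_nonneg by (auto simp: h_def)
    have "h * (4 * (2 * \<delta> + 1) + 1) \<le> e\<^sup>2"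
      using \<delta>_nonneg by (subst pos_le_divide_eq[symmetric]) (auto simp: h_def)
    then have "4 * (2 * \<delta> * h + h) < e\<^sup>2"
      using h(1) by (simp add: algebra_simps)
    moreover have "4 * (2 * \<delta> * h + h * h) \<le> 4 * (2 * \<delta> * h + h)"
      using h by (intro mult_left_mono add_left_mono mult_left_le) auto
    ultimately have he: "4 * (2 * \<delta> * h + h * h) < e\<^sup>2"
      by (rule order_le_less_trans[rotated])
    obtain N where N: "N > 0" "\<And>n. n \<ge> N \<Longrightarrow> norm (A n) < \<delta> + h"
      using near[OF h(1)] by blast
    have "dist (A m) (A n) < e" if "m \<ge> N" "n \<ge> N" for m n
    proof -
      have "(norm (A n))\<^sup>2 \<le> (\<delta> + h)\<^sup>2" "(norm (A m))\<^sup>2 \<le> (\<delta> + h)\<^sup>2"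
        using N(2)[OF that(1)] N(2)[OF that(2)] by (auto intro!: power_mono)
      moreover have "(2 * \<delta>)\<^sup>2 \<le> (norm (A m + A n))\<^sup>2"
        using half[of m n] N(1) that \<delta>_nonneg by (intro power_mono) auto
      ultimately have "(norm (A m - A n))\<^sup>2 < e\<^sup>2"
        using parallelogram_law[of "A m" "A n"] he by (simp add: power2_eq_square algebra_simps)
      then show ?thesis
        using \<open>e > 0\<close> by (simp add: dist_norm power2_less_imp_less)
    qed
    then show "\<exists>N. \<forall>m\<ge>N. \<forall>n\<ge>N. dist (A m) (A n) < e" by blast
  qed
  then obtain p where p: "A \<longlonglongrightarrow> p"
    using Cauchy_convergent convergent_def by blast
  have "(\<lambda>n. norm (K (A n) - A n)) \<longlonglongrightarrow> 0"
  proof (rule tendsto_sandwich[where f = "\<lambda>_. 0" and h = "\<lambda>n. 2 * norm x * inverse (real n)"])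
    have "norm (K (A n) - A n) = norm (K (orbit_sum K n x) - orbit_sum K n x) * inverse (real n)" for n
      unfolding A_def by (simp add: isometry_scaleR flip: scaleR_diff_right)
    then show "\<forall>\<^sub>F n in sequentially. norm (K (A n) - A n) \<le> 2 * norm x * inverse (real n)"
      using norm_shift_orbit_sum_le[of 1 _ x] by (auto intro!: always_eventually mult_right_mono)
    show "(\<lambda>n. 2 * norm x * inverse (real n)) \<longlonglongrightarrow> 0"
      using tendsto_mult_right_zero[OF lim_inverse_n] by blast
  qed auto
  then have "(\<lambda>n. K (A n) - A n) \<longlonglongrightarrow> 0"
    by (rule tendsto_norm_zero_cancel)
  moreover have "(\<lambda>n. K (A n)) \<longlonglongrightarrow> K p"
    using p isometry_norm unfolding tendsto_iff dist_norm isometry_diff[symmetric] by simp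
  ultimately have "K p - p = 0"
    using p LIMSEQ_unique tendsto_diff by metis
  with p show thesis by (intro that[of p]) (simp_all add: A_def[abs_def])
qed

lemma orbit_mean_tendsto_0:
  assumes "\<And>q. K q = q \<Longrightarrow> cinner x q = 0"
  shows "(\<lambda>n. orbit_sum K n x /\<^sub>R real n) \<longlonglongrightarrow> 0"
proof -
  obtain p where p: "K p = p" "(\<lambda>n. orbit_sum K n x /\<^sub>R real n) \<longlonglongrightarrow> p"
    by (rule mean_ergodic)
  have "(K ^^ k) p = p" for k
    using p(1) by (induction k) simp_all
  then have "cinner ((K ^^ k) x) p = 0" for k
    using iterate_cinner[of k x p] assms[OF p(1)] by simp
  then have orth: "cinner (orbit_sum K n x /\<^sub>R real n) p = 0" for n
    by (simp add: scaleR_scaleC cinner_scaleC_left orbit_sum_def cinner_sum_left)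
  have "(norm p)\<^sup>2 \<le> norm (p - orbit_sum K n x /\<^sub>R real n) * norm p" for n
    using cinner_Cauchy_Schwarz[of "p - orbit_sum K n x /\<^sub>R real n" p]
    by (simp add: cinner_diff_left orth cinner_self norm_power)
  moreover have "(\<lambda>n. norm (p - orbit_sum K n x /\<^sub>R real n) * norm p) \<longlonglongrightarrow> norm (p - p) * norm p"
    by (intro tendsto_intros p)
  ultimately have "(norm p)\<^sup>2 \<le> norm (p - p) * norm p"
    by (intro tendsto_lowerbound[where F = sequentially]) auto
  with p show ?thesis by simp
qed

end

lemma tendsto_scaleC_left [tendsto_intros]:
  fixes w :: "'a::complex_inner"
  assumes "(u \<longlongrightarrow> c) F"
  shows "((\<lambda>t. u t *\<^sub>C w) \<longlongrightarrow> c *\<^sub>C w) F"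
proof -
  have "bounded_linear (\<lambda>c. c *\<^sub>C w)"
    by (rule bounded_linear_intro[where K = "norm w"])
      (simp_all add: scaleC_add_left scaleR_scaleC scaleC_scaleC norm_scaleC scaleR_conv_of_real)
  then show ?thesis using assms by (rule bounded_linear.tendsto)
qed

text \<open>A fixed point of \<open>c K\<close> is an eigenvector of \<open>K\<close>, so for each \<open>c\<close> on the unit circle the means of
  \<open>g\<close> under \<open>c K\<close> tend to zero. A mean of fixed length depends continuously on \<open>c\<close>, and
  smallness of one mean forces smallness of all much longer ones; compactness of the circle therefore
  makes the convergence uniform. This replaces the statement that the spectral measure of \<open>g\<close>
  has no atoms, together with Wiener's lemma.\<close>

lemma (in isometry) uniform_rotated_orbit_means:
  assumes orth: "\<And>w. w \<in> eigenvectors K \<Longrightarrow> cinner g w = 0"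
    and "\<epsilon> > 0"
  obtains n0 where
    "\<And>n c. n \<ge> n0 \<Longrightarrow> cmod c = 1 \<Longrightarrow> norm (\<Sum>k<n. (c ^ k) *\<^sub>C (K ^^ k) g) \<le> \<epsilon> * real n"
proof -
  define U where "U c = (\<lambda>x. c *\<^sub>C K x)" for c
  have isoU: "isometry (U c)" if "cmod c = 1" for c
    unfolding U_def using isometry_rotate[OF that] .
  have orbit_U: "orbit_sum (U c) n g = (\<Sum>k<n. (c ^ k) *\<^sub>C (K ^^ k) g)" for c n
    by (simp add: orbit_sum_def U_def funpow_rotate)
  define V where "V m = {c. norm (orbit_sum (U c) m g) < \<epsilon> / 2 * real m}" for m
  have "open (V m)" for m
  proof -
    have "continuous_on UNIV (\<lambda>c. norm (orbit_sum (U c) m g))"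
      unfolding orbit_U by (intro continuous_on_norm continuous_on_sum)
        (auto simp: continuous_on_def intro!: tendsto_intros)
    then show ?thesis
      unfolding V_def by (intro open_Collect_less continuous_on_const)
  qed
  then have V_open: "\<And>m. m \<in> {0<..} \<Longrightarrow> open (V m)" .
  have cover: "sphere 0 1 \<subseteq> (\<Union>m\<in>{0<..}. V m)"
  proof
    fix c :: complex assume "c \<in> sphere 0 1"
    then have c: "cmod c = 1" by simp
    have "cinner g q = 0" if "U c q = q" for q
    proof (cases "q = 0")
      case False
      have "K q = cnj c *\<^sub>C q"
      proof -
        have "cnj c *\<^sub>C U c q = K q"
          using c by (simp add: U_def scaleC_scaleC mult.commute complex_norm_square[symmetric] scaleC_one)
        with that show ?thesis by simp
      qed
      with False show ?thesis
        by (intro orth) (auto simp: eigenvectors_def is_eigenvector_def)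
    qed simp
    then have "(\<lambda>n. orbit_sum (U c) n g /\<^sub>R real n) \<longlonglongrightarrow> 0"
      by (rule isometry.orbit_mean_tendsto_0[OF isoU[OF c]])
    from tendstoD[OF this, of "\<epsilon> / 2"]
    have "eventually (\<lambda>n. norm (orbit_sum (U c) n g /\<^sub>R real n) < \<epsilon> / 2) sequentially"
      using \<open>\<epsilon> > 0\<close> by (simp only: dist_norm diff_0_right half_gt_zero)
    from eventually_happens[OF eventually_conj[OF eventually_gt_at_top[of 0] this]]
    obtain n where "n > 0" "norm (orbit_sum (U c) n g /\<^sub>R real n) < \<epsilon> / 2"
      by auto
    then show "c \<in> (\<Union>m\<in>{0<..}. V m)"
      by (auto simp: V_def field_simps)
  qed
  obtain M where M: "M \<subseteq> {0<..}" "finite M" "sphere 0 1 \<subseteq> (\<Union>m\<in>M. V m)"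
    by (rule compactE_image[OF compact_sphere V_open cover])
  define B where "B = Max M"
  have B: "m \<le> B" if "m \<in> M" for m
    using that M(2) by (simp add: B_def)
  obtain n0 :: nat where n0: "4 * real B * norm g / \<epsilon> < real n0"
    using reals_Archimedean2 by blast
  have "norm (orbit_sum (U c) n g) \<le> \<epsilon> * real n" if n: "n \<ge> Suc n0" and c: "cmod c = 1" for n c
  proof -
    obtain m where m: "m \<in> M" "c \<in> V m"
      using M(3) c by auto
    have "m > 0" using m(1) M(1) by auto
    have "2 * real m * norm g \<le> 2 * real B * norm g"
      using B[OF m(1)] by (intro mult_right_mono) auto
    also have "\<dots> \<le> \<epsilon> / 2 * real n0"
      using n0 \<open>\<epsilon> > 0\<close> by (simp add: field_simps)
    also have "\<dots> \<le> \<epsilon> / 2 * real n"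
      using n \<open>\<epsilon> > 0\<close> by simp
    finally have "2 * real m * norm g / real n \<le> \<epsilon> / 2"
      using n by (simp add: field_simps)
    moreover have "norm (orbit_sum (U c) m g) / real m < \<epsilon> / 2"
      using m(2) \<open>m > 0\<close> by (simp add: V_def field_simps)
    ultimately have "norm (orbit_sum (U c) n g) / real n \<le> \<epsilon>"
      using isometry.norm_orbit_mean_le[OF isoU[OF c] \<open>m > 0\<close>, of n g] n by linarith
    then show ?thesis using n by (simp add: field_simps)
  qed
  then show thesis by (intro that[of "Suc n0"]) (simp_all add: orbit_U)
qed

section \<open>From rotated orbit sums to arbitrary coefficients\<close>

lemma sum_roots_of_unity_powers:
  fixes s t M :: nat
  assumes "s < M" "t < M"
  defines "\<omega> \<equiv> \<lambda>l. cis (2 * pi * real l / real M)"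
  shows "(\<Sum>l<M. \<omega> l ^ s * cnj (\<omega> l ^ t)) = (if s = t then of_nat M else 0)"
proof (cases "s = t")
  case True
  have "\<omega> l ^ t * cnj (\<omega> l ^ t) = 1" for l
    using complex_norm_square[of "\<omega> l ^ t"] by (simp add: \<omega>_def norm_power)
  with True show ?thesis by simp
next
  case False
  have M: "M > 0" using assms(1) by simp
  define \<zeta> where "\<zeta> = cis (2 * pi * (real s - real t) / real M)"
  have powers: "\<omega> l ^ s * cnj (\<omega> l ^ t) = \<zeta> ^ l" for l
    by (simp add: \<omega>_def \<zeta>_def DeMoivre cis_cnj cis_mult field_simps diff_divide_distrib)
  have "\<zeta> ^ M = cis (2 * pi * of_int (int s - int t))"
    using M by (simp add: \<zeta>_def DeMoivre)
  then have "\<zeta> ^ M = 1"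
    by (simp only: cis_multiple_2pi Ints_of_int)
  moreover have "\<zeta> \<noteq> 1"
  proof
    assume "\<zeta> = 1"
    then have "cos (2 * pi * (real s - real t) / real M) = 1"
      by (simp add: \<zeta>_def complex_eq_iff)
    then obtain k :: int where "2 * pi * (real s - real t) / real M = of_int k * 2 * pi"
      by (auto simp: cos_one_2pi_int)
    then have "2 * pi * (real s - real t) = 2 * pi * (of_int k * real M)"
      using M by (simp add: field_simps)
    then have "real s - real t = of_int k * real M"
      using mult_left_cancel[of "2 * pi"] by simp
    then have "int s - int t = k * int M"
      by (metis (mono_tags, opaque_lifting) of_int_diff of_int_eq_iff of_int_mult of_int_of_nat_eq)
    then have "int M dvd (int s - int t)" by simp
    moreover have "\<bar>int s - int t\<bar> < int M" using assms(1,2) by linarith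
    ultimately show False
      using False zdvd_imp_le[of "int M" "\<bar>int s - int t\<bar>"] by simp
  qed
  ultimately show ?thesis
    using False unfolding powers by (simp add: geometric_sum)
qed

lemma cinner_sum_sum:
  fixes u :: "_ \<Rightarrow> 'a::complex_inner"
  shows "cinner (\<Sum>i\<in>A. u i) (\<Sum>j\<in>B. v j) = (\<Sum>i\<in>A. \<Sum>j\<in>B. cinner (u i) (v j))"
  unfolding cinner_sum_left by (simp only: cinner_sum_right)

text \<open>Parseval's identity on the cyclic group of order \<open>M\<close>, for vector-valued sequences supported on
  an initial segment.\<close>

lemma Parseval_cyclic:
  fixes y :: "nat \<Rightarrow> 'a::complex_inner" and M :: nat
  assumes "n \<le> M"
  defines "\<omega> \<equiv> \<lambda>l. cis (2 * pi * real l / real M)"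
  shows "(\<Sum>l<M. (norm (\<Sum>t<n. (\<omega> l ^ t) *\<^sub>C y t))\<^sup>2) = real M * (\<Sum>t<n. (norm (y t))\<^sup>2)"
proof -
  have "complex_of_real (\<Sum>l<M. (norm (\<Sum>t<n. (\<omega> l ^ t) *\<^sub>C y t))\<^sup>2)
      = (\<Sum>l<M. \<Sum>s<n. \<Sum>t<n. \<omega> l ^ s * cnj (\<omega> l ^ t) * cinner (y s) (y t))"
    by (simp only: of_real_sum cinner_self[symmetric] cinner_sum_sum
        cinner_scaleC_left cinner_scaleC_right mult_ac)
  also have "\<dots> = (\<Sum>s<n. \<Sum>t<n. (\<Sum>l<M. \<omega> l ^ s * cnj (\<omega> l ^ t)) * cinner (y s) (y t))"
    unfolding sum_distrib_right by (subst sum.swap, rule sum.cong[OF refl], subst sum.swap, rule refl)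
  also have "\<dots> = (\<Sum>s<n. \<Sum>t<n. if s = t then of_nat M * cinner (y s) (y t) else 0)"
    using assms(1) unfolding \<omega>_def
    by (intro sum.cong refl) (subst sum_roots_of_unity_powers, auto)
  also have "\<dots> = complex_of_real (real M * (\<Sum>t<n. (norm (y t))\<^sup>2))"
    by (simp add: sum.delta cinner_self sum_distrib_left)
  finally show ?thesis by (simp only: of_real_eq_iff)
qed

text \<open>Smallness on the exponentials \<open>k \<mapsto> c\<^sup>k\<close> controls all coefficient sequences: compared with the
  bound \<open>n \<parallel>h\<parallel>\<^sup>2 \<Sum>\<^sub>k \<bar>x\<^sub>k\<bar>\<^sup>2\<close> from Cauchy-Schwarz, the small factor \<open>4 \<eta>\<^sup>2\<close> replaces \<open>\<parallel>h\<parallel>\<^sup>2\<close>.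
  Write \<open>y\<close> for the combination. Since \<open>K\<close> is an isometry, \<open>n \<parallel>y\<parallel>\<^sup>2\<close>
  is the sum over \<open>t < n\<close> of \<open>\<langle>K\<^sup>t y, \<Sum>\<^sub>k x\<^sub>k K\<^sup>t\<^sup>+\<^sup>k h\<rangle>\<close>. Detecting the index \<open>t + k\<close> by
  orthogonality of the \<open>2n\<close>-th roots of unity separates the variables: the sum becomes an average of
  products of three transforms, of \<open>x\<close>, of the orbit of \<open>y\<close> and of the orbit of \<open>h\<close>. The last
  one is bounded by the hypothesis, the other two by Parseval and Cauchy-Schwarz.\<close>

lemma (in isometry) norm_orbit_combination_le:
  fixes x :: "nat \<Rightarrow> complex"
  assumes small: "\<And>c. cmod c = 1 \<Longrightarrow> norm (\<Sum>k<2*n. (c ^ k) *\<^sub>C (K ^^ k) h) \<le> \<eta> * real (2 * n)"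
    and "\<eta> \<ge> 0"
  shows "(norm (\<Sum>k<n. x k *\<^sub>C (K ^^ k) h))\<^sup>2 \<le> 4 * \<eta>\<^sup>2 * real n * (\<Sum>k<n. (cmod (x k))\<^sup>2)"
proof -
  \<comment> \<open>Twice \<open>n\<close> frequencies, so that the indices \<open>t + k\<close> with \<open>t, k < n\<close> do not wrap around.\<close>
  define M where "M = 2 * n"
  define \<omega> where "\<omega> l = cis (2 * pi * real l / real M)" for l :: nat
  define y where "y = (\<Sum>k<n. x k *\<^sub>C (K ^^ k) h)"
  define Y where "Y l = (\<Sum>t<n. (\<omega> l ^ t) *\<^sub>C (K ^^ t) y)" for l
  define X where "X l = (\<Sum>k<n. \<omega> l ^ k * cnj (x k))" for l
  define H where "H l = (\<Sum>j<M. (\<omega> l ^ j) *\<^sub>C (K ^^ j) h)" for l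
  define X2 where "X2 = (\<Sum>k<n. (cmod (x k))\<^sup>2)"
  have X2: "X2 \<ge> 0" unfolding X2_def by (intro sum_nonneg) simp
  show ?thesis
  proof (cases "y = 0 \<or> n = 0")
    case True
    then have "y = 0" by (auto simp: y_def)
    then show ?thesis
      using X2 by (simp add: y_def[symmetric] X2_def[symmetric])
  next
    case False
    then have n: "n > 0" and y: "norm y > 0" by auto
    have rotate_sums: "(\<Sum>t<n. \<Sum>k<n. \<Sum>j<M. \<Sum>l<M. F t k j l) = (\<Sum>l<M. \<Sum>t<n. \<Sum>k<n. \<Sum>j<M. F t k j l)"
      for F :: "nat \<Rightarrow> nat \<Rightarrow> nat \<Rightarrow> nat \<Rightarrow> complex"
    proof -
      have "(\<Sum>j<M. \<Sum>l<M. F t k j l) = (\<Sum>l<M. \<Sum>j<M. F t k j l)" for t k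
        by (rule sum.swap)
      moreover have "(\<Sum>k<n. \<Sum>l<M. \<Sum>j<M. F t k j l) = (\<Sum>l<M. \<Sum>k<n. \<Sum>j<M. F t k j l)" for t
        by (rule sum.swap)
      moreover have "(\<Sum>t<n. \<Sum>l<M. \<Sum>k<n. \<Sum>j<M. F t k j l) = (\<Sum>l<M. \<Sum>t<n. \<Sum>k<n. \<Sum>j<M. F t k j l)"
        by (rule sum.swap)
      ultimately show ?thesis by simp
    qed
    have Y_sq: "(\<Sum>l<M. (norm (Y l))\<^sup>2) = real M * (real n * (norm y)\<^sup>2)"
      unfolding Y_def \<omega>_def by (subst Parseval_cyclic) (simp_all add: M_def)
    have "(\<Sum>l<M. (norm (\<Sum>k<n. (\<omega> l ^ k) *\<^sub>C (cnj (x k) *\<^sub>C y)))\<^sup>2) = real M * (X2 * (norm y)\<^sup>2)"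
      unfolding \<omega>_def
      by (subst Parseval_cyclic)
        (simp_all add: M_def X2_def norm_scaleC power_mult_distrib sum_distrib_right)
    moreover have "(\<Sum>k<n. (\<omega> l ^ k) *\<^sub>C (cnj (x k) *\<^sub>C y)) = X l *\<^sub>C y" for l
      by (simp add: X_def scaleC_scaleC complex_vector.scale_sum_left)
    ultimately have X_sq: "(\<Sum>l<M. (cmod (X l))\<^sup>2) = real M * X2"
      using y by (simp add: norm_scaleC power_mult_distrib flip: sum_distrib_right)
    have "complex_of_real (real M * (real n * (norm y)\<^sup>2)) = of_nat M * (\<Sum>t<n. cinner ((K ^^ t) y) ((K ^^ t) y))"
      by (simp add: cinner_self)
    also have "\<dots> = (\<Sum>t<n. \<Sum>k<n. of_nat M * (cnj (x k) * cinner ((K ^^ t) y) ((K ^^ (t + k)) h)))"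
      by (subst (2) y_def) (simp add: iterate_sum iterate_scaleC cinner_sum_right cinner_scaleC_right
          sum_distrib_left funpow_add del: iterate_cinner)
    also have "\<dots> = (\<Sum>t<n. \<Sum>k<n. \<Sum>j<M. (\<Sum>l<M. \<omega> l ^ (t + k) * cnj (\<omega> l ^ j))
        * (cnj (x k) * cinner ((K ^^ t) y) ((K ^^ j) h)))"
    proof (intro sum.cong refl)
      fix t k assume "t \<in> {..<n}" "k \<in> {..<n}"
      then have tk: "t + k < M" by (simp add: M_def)
      have "(\<Sum>j<M. (\<Sum>l<M. \<omega> l ^ (t + k) * cnj (\<omega> l ^ j)) * (cnj (x k) * cinner ((K ^^ t) y) ((K ^^ j) h)))
          = (\<Sum>j<M. if t + k = j then of_nat M * (cnj (x k) * cinner ((K ^^ t) y) ((K ^^ j) h)) else 0)"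
        unfolding \<omega>_def by (intro sum.cong refl) (subst sum_roots_of_unity_powers[OF tk], auto)
      then show "of_nat M * (cnj (x k) * cinner ((K ^^ t) y) ((K ^^ (t + k)) h))
          = (\<Sum>j<M. (\<Sum>l<M. \<omega> l ^ (t + k) * cnj (\<omega> l ^ j)) * (cnj (x k) * cinner ((K ^^ t) y) ((K ^^ j) h)))"
        using tk by simp
    qed
    also have "\<dots> = (\<Sum>t<n. \<Sum>k<n. \<Sum>j<M. \<Sum>l<M. \<omega> l ^ (t + k) * cnj (\<omega> l ^ j)
        * (cnj (x k) * cinner ((K ^^ t) y) ((K ^^ j) h)))"
      by (simp only: sum_distrib_right)
    also have "\<dots> = (\<Sum>l<M. \<Sum>t<n. \<Sum>k<n. \<Sum>j<M. \<omega> l ^ (t + k) * cnj (\<omega> l ^ j)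
        * (cnj (x k) * cinner ((K ^^ t) y) ((K ^^ j) h)))"
      by (rule rotate_sums)
    also have "\<dots> = (\<Sum>l<M. X l * cinner (Y l) (H l))"
    proof (intro sum.cong refl)
      fix l
      have "cinner (Y l) (H l) = (\<Sum>t<n. \<Sum>j<M. \<omega> l ^ t * cnj (\<omega> l ^ j) * cinner ((K ^^ t) y) ((K ^^ j) h))"
        by (simp only: Y_def H_def cinner_sum_sum cinner_scaleC_left
            cinner_scaleC_right mult_ac)
      then have "X l * cinner (Y l) (H l) = (\<Sum>k<n. \<Sum>t<n. \<Sum>j<M. \<omega> l ^ k * cnj (x k) *
          (\<omega> l ^ t * cnj (\<omega> l ^ j) * cinner ((K ^^ t) y) ((K ^^ j) h)))"
        unfolding X_def by (simp only: sum_distrib_right) (simp only: sum_distrib_left)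
      also have "\<dots> = (\<Sum>t<n. \<Sum>k<n. \<Sum>j<M. \<omega> l ^ k * cnj (x k) *
          (\<omega> l ^ t * cnj (\<omega> l ^ j) * cinner ((K ^^ t) y) ((K ^^ j) h)))"
        by (rule sum.swap)
      finally show "(\<Sum>t<n. \<Sum>k<n. \<Sum>j<M. \<omega> l ^ (t + k) * cnj (\<omega> l ^ j)
          * (cnj (x k) * cinner ((K ^^ t) y) ((K ^^ j) h))) = X l * cinner (Y l) (H l)"
        by (simp add: power_add mult_ac)
    qed
    finally have "real M * (real n * (norm y)\<^sup>2) = cmod (\<Sum>l<M. X l * cinner (Y l) (H l))"
      by (metis abs_of_nonneg mult_nonneg_nonneg norm_of_real of_nat_0_le_iff zero_le_power2)
    also have "\<dots> \<le> (\<Sum>l<M. cmod (X l) * (norm (Y l) * (\<eta> * real M)))"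
    proof (rule sum_norm_le)
      fix l
      have "norm (H l) \<le> \<eta> * real M"
        unfolding H_def M_def by (rule small) (simp add: \<omega>_def)
      then show "cmod (X l * cinner (Y l) (H l)) \<le> cmod (X l) * (norm (Y l) * (\<eta> * real M))"
        unfolding norm_mult
        by (intro mult_left_mono order_trans[OF cinner_Cauchy_Schwarz]) auto
    qed
    also have "\<dots> = \<eta> * real M * (\<Sum>l<M. cmod (X l) * norm (Y l))"
      by (simp add: sum_distrib_left mult_ac)
    finally have le: "real n * (norm y)\<^sup>2 \<le> \<eta> * (\<Sum>l<M. cmod (X l) * norm (Y l))"
      using n by (simp add: M_def mult_ac)
    have "(real n * (norm y)\<^sup>2)\<^sup>2 \<le> (\<eta> * (\<Sum>l<M. cmod (X l) * norm (Y l)))\<^sup>2"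
      by (intro power_mono le) simp
    also have "\<dots> = \<eta>\<^sup>2 * (\<Sum>l<M. cmod (X l) * norm (Y l))\<^sup>2"
      by (simp add: power_mult_distrib)
    also have "\<dots> \<le> \<eta>\<^sup>2 * ((\<Sum>l<M. (cmod (X l))\<^sup>2) * (\<Sum>l<M. (norm (Y l))\<^sup>2))"
      by (intro mult_left_mono Cauchy_Schwarz_ineq_sum) simp
    also have "\<dots> = (4 * \<eta>\<^sup>2 * real n * X2) * (real n * (real n * (norm y)\<^sup>2))"
      unfolding X_sq Y_sq by (simp add: M_def power2_eq_square)
    finally have "(norm y)\<^sup>2 * (real n * (real n * (norm y)\<^sup>2)) \<le> (4 * \<eta>\<^sup>2 * real n * X2) * (real n * (real n * (norm y)\<^sup>2))"
      by (simp add: power2_eq_square mult_ac)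
    then have "(norm y)\<^sup>2 \<le> 4 * \<eta>\<^sup>2 * real n * X2"
      by (rule mult_right_le_imp_le) (use n y in simp)
    then show ?thesis
      by (simp add: y_def X2_def)
  qed
qed

section \<open>Eigenvalues of Hermitian matrices\<close>

text \<open>Vectors in \<open>\<complex>\<^sup>n\<close> are functions on \<open>nat\<close> of which only the values below \<open>n\<close> matter, so that
  finite linear combinations are ordinary sums of functions.\<close>

definition dot :: "nat \<Rightarrow> (nat \<Rightarrow> complex) \<Rightarrow> (nat \<Rightarrow> complex) \<Rightarrow> complex" where
  "dot n x y = (\<Sum>p<n. x p * cnj (y p))"

definition sq_norm :: "nat \<Rightarrow> (nat \<Rightarrow> complex) \<Rightarrow> real" where
  "sq_norm n x = (\<Sum>p<n. (cmod (x p))\<^sup>2)"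

definition app :: "nat \<Rightarrow> (nat \<Rightarrow> nat \<Rightarrow> complex) \<Rightarrow> (nat \<Rightarrow> complex) \<Rightarrow> nat \<Rightarrow> complex" where
  "app n A x p = (\<Sum>q<n. A p q * x q)"

lemma sq_norm_nonneg [simp]: "sq_norm n x \<ge> 0"
  by (simp add: sq_norm_def sum_nonneg)

lemma dot_self: "dot n x x = complex_of_real (sq_norm n x)"
  by (simp add: dot_def sq_norm_def complex_norm_square del: of_real_power)

lemma sq_norm_eq_0_iff: "sq_norm n x = 0 \<longleftrightarrow> (\<forall>p<n. x p = 0)"
  by (auto simp: sq_norm_def sum_nonneg_eq_0_iff)

lemma dot_commute: "dot n x y = cnj (dot n y x)"
  by (simp add: dot_def mult.commute)

lemma dot_cong: "(\<And>p. p < n \<Longrightarrow> x p = x' p) \<Longrightarrow> (\<And>p. p < n \<Longrightarrow> y p = y' p) \<Longrightarrow> dot n x y = dot n x' y'"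
  by (simp add: dot_def)

lemma dot_diff_left: "dot n (\<lambda>p. x p - y p) z = dot n x z - dot n y z"
  and dot_scale_left: "dot n (\<lambda>p. c * x p) z = c * dot n x z"
  and dot_scale_right: "dot n z (\<lambda>p. c * x p) = cnj c * dot n z x"
  by (simp_all add: dot_def sum.distrib sum_subtractf sum_distrib_left algebra_simps)

lemma dot_sum_left: "dot n (\<lambda>p. \<Sum>j\<in>J. c j * w j p) z = (\<Sum>j\<in>J. c j * dot n (w j) z)"
  and dot_sum_right: "dot n z (\<lambda>p. \<Sum>j\<in>J. c j * w j p) = (\<Sum>j\<in>J. cnj (c j) * dot n z (w j))"
  unfolding dot_def
  by (simp_all add: sum_distrib_left sum_distrib_right mult_ac) (subst sum.swap, rule refl)+

lemma dot_Cauchy_Schwarz: "(cmod (dot n x y))\<^sup>2 \<le> sq_norm n x * sq_norm n y"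
proof -
  have "cmod (dot n x y) \<le> (\<Sum>p<n. cmod (x p) * cmod (y p))"
    unfolding dot_def by (rule sum_norm_le) (simp add: norm_mult)
  then have "(cmod (dot n x y))\<^sup>2 \<le> (\<Sum>p<n. cmod (x p) * cmod (y p))\<^sup>2"
    by (intro power_mono) auto
  also have "\<dots> \<le> sq_norm n x * sq_norm n y"
    unfolding sq_norm_def by (rule Cauchy_Schwarz_ineq_sum)
  finally show ?thesis .
qed

lemma app_cong: "(\<And>p. p < n \<Longrightarrow> x p = x' p) \<Longrightarrow> app n A x = app n A x'"
  by (auto simp: app_def)

lemma app_diff: "app n A (\<lambda>p. x p - y p) = (\<lambda>p. app n A x p - app n A y p)"
  and app_scale: "app n A (\<lambda>p. c * x p) = (\<lambda>p. c * app n A x p)"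
  by (simp_all add: app_def[abs_def] sum_subtractf sum_distrib_left algebra_simps)

lemma app_sum: "app n A (\<lambda>p. \<Sum>j\<in>J. c j * w j p) = (\<lambda>p. \<Sum>j\<in>J. c j * app n A (w j) p)"
  unfolding app_def by (simp add: sum_distrib_left mult_ac) (subst sum.swap, rule refl)

lemma app_app: "app n A (app n B x) p = app n (\<lambda>p q. \<Sum>r<n. A p r * B r q) x p"
  unfolding app_def by (simp add: sum_distrib_left sum_distrib_right mult_ac) (subst sum.swap, rule refl)

lemma dot_app_hermitian:
  assumes "\<And>p q. p < n \<Longrightarrow> q < n \<Longrightarrow> A p q = cnj (A q p)"
  shows "dot n (app n A x) y = dot n x (app n A y)"
proof -
  have "dot n (app n A x) y = (\<Sum>p<n. \<Sum>q<n. A p q * x q * cnj (y p))"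
    by (simp add: dot_def app_def sum_distrib_right)
  also have "\<dots> = (\<Sum>p<n. \<Sum>q<n. x q * cnj (A q p * y p))"
    by (intro sum.cong refl) (subst assms, auto)
  also have "\<dots> = dot n x (app n A y)"
    by (subst sum.swap) (simp add: dot_def app_def sum_distrib_left)
  finally show ?thesis .
qed

lemma homogeneous_system_solution:
  fixes c :: "nat \<Rightarrow> nat \<Rightarrow> complex"
  obtains x where "\<exists>j<Suc m. x j \<noteq> 0" "\<And>i. i < m \<Longrightarrow> (\<Sum>j<Suc m. c i j * x j) = 0"
proof -
  \<comment> \<open>A zero row makes the system square and its determinant zero.\<close>
  define A where "A = Matrix.mat (Suc m) (Suc m) (\<lambda>(i, j). if i < m then c i j else 0)"
  have A: "A \<in> carrier_mat (Suc m) (Suc m)" by (simp add: A_def)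
  have "A = mat\<^sub>r (Suc m) (Suc m) (\<lambda>i. if i = m then 0\<^sub>v (Suc m) else Matrix.vec (Suc m) (c i))"
    by (rule eq_matI) (auto simp: A_def)
  then have "det A = 0"
    by (simp add: det_row_0)
  then obtain v where v: "v \<in> carrier_vec (Suc m)" "v \<noteq> 0\<^sub>v (Suc m)" "A *\<^sub>v v = 0\<^sub>v (Suc m)"
    using det_0_iff_vec_prod_zero[OF A] by auto
  show thesis
  proof (rule that[of "\<lambda>j. v $ j"])
    show "\<exists>j<Suc m. v $ j \<noteq> 0"
      using v(1,2) by (metis carrier_vecD eq_vecI index_zero_vec)
    fix i assume i: "i < m"
    then have "(A *\<^sub>v v) $ i = (\<Sum>j<Suc m. c i j * v $ j)"
      using v(1) by (simp add: A_def scalar_prod_def atLeast0LessThan)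
    with v(3) i show "(\<Sum>j<Suc m. c i j * v $ j) = 0" by simp
  qed
qed

text \<open>The spectral theorem with the eigenvectors in a prescribed order of the eigenvalues. A Schur
  decomposition \<open>A = P B Q\<close> has the eigenvalues on the diagonal of \<open>B\<close> in that order. The first \<open>k\<close>
  columns of \<open>P\<close> span an \<open>A\<close>-invariant flag; orthonormalising them by Gram-Schmidt keeps the flag,
  and the new vectors are eigenvectors: the defect \<open>A u - \<lambda>\<^sub>k u\<close> lies in the previous flag space
  because \<open>B\<close> is triangular, and it is orthogonal to that space because \<open>A\<close> is Hermitian.\<close>

lemma ordered_eigenbasis:
  fixes A :: "complex mat"
  assumes A: "A \<in> carrier_mat n n"
    and herm: "\<And>p q. p < n \<Longrightarrow> q < n \<Longrightarrow> A $$ (p, q) = cnj (A $$ (q, p))"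
    and eigvals: "ordered_eigenvalues A d"
  obtains w where "\<And>i j. i < n \<Longrightarrow> j < n \<Longrightarrow> dot n (w i) (w j) = (if i = j then 1 else 0)"
    "\<And>j p. j < n \<Longrightarrow> p < n \<Longrightarrow> app n (\<lambda>p q. A $$ (p, q)) (w j) p = complex_of_real (d (Suc j)) * w j p"
    "\<And>x p. p < n \<Longrightarrow> x p = (\<Sum>j<n. dot n x (w j) * w j p)"
proof -
  define ev where "ev j = complex_of_real (d (Suc j))" for j
  have "char_poly A = (\<Prod>i\<in>{1..n}. [:- complex_of_real (d i), 1:])"
    using eigvals A by (simp add: ordered_eigenvalues_def)
  also have "{1..n} = Suc ` {..<n}"
    by (simp add: image_Suc_lessThan)
  also have "(\<Prod>i\<in>Suc ` {..<n}. [:- complex_of_real (d i), 1:]) = (\<Prod>e\<leftarrow>map ev [0..<n]. [:- e, 1:])"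
    by (simp add: prod.reindex ev_def prod.distinct_set_conv_list[symmetric] comp_def atLeast0LessThan)
  finally have c: "char_poly A = (\<Prod>e\<leftarrow>map ev [0..<n]. [:- e, 1:])" .
  obtain B P Q where dec: "schur_decomposition A (map ev [0..<n]) = (B, P, Q)"
    by (cases "schur_decomposition A (map ev [0..<n])")
  have wit: "similar_mat_wit A B P Q" and tri: "upper_triangular B" and diag: "diag_mat B = map ev [0..<n]"
    using schur_decomposition[OF A c dec] by auto
  note carr = similar_mat_witD2[OF A wit]
  have B_diag: "B $$ (k, k) = ev k" if "k < n" for k
    using arg_cong[OF diag, of "\<lambda>xs. xs ! k"] that carr by (simp add: diag_mat_def)
  have B_tri: "B $$ (l, k) = 0" if "k < l" "l < n" for k l
    using tri that carr by auto
  define a where "a p q = A $$ (p, q)" for p q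
  have a_herm: "dot n (app n a x) y = dot n x (app n a y)" for x y
    by (rule dot_app_hermitian) (auto simp: a_def intro: herm)
  define coord where "coord = app n (\<lambda>p q. Q $$ (p, q))"
  \<comment> \<open>\<open>flag k\<close> is the span of the first \<open>k\<close> columns of \<open>P\<close>, described by coordinates.\<close>
  define flag where "flag k x \<longleftrightarrow> (\<forall>l. k \<le> l \<longrightarrow> l < n \<longrightarrow> coord x l = 0)" for k x
  have coord_diff: "coord (\<lambda>p. x p - y p) l = coord x l - coord y l"
    and coord_scale: "coord (\<lambda>p. c * x p) l = c * coord x l"
    and coord_sum: "coord (\<lambda>p. \<Sum>j\<in>J. e j * w j p) l = (\<Sum>j\<in>J. e j * coord (w j) l)"
    for x y l c and J :: "nat set" and e w
    by (simp_all add: coord_def app_diff app_scale app_sum)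
  have QA: "coord (app n a x) l = (\<Sum>k<n. B $$ (l, k) * coord x k)" if "l < n" for x l
  proof -
    have "Q * A = Q * (P * (B * Q))"
      using carr assoc_mult_mat[OF carr(6,5,7)] by simp
    also have "\<dots> = (Q * P) * (B * Q)"
      using assoc_mult_mat[OF carr(7,6) mult_carrier_mat[OF carr(5,7)]] by simp
    also have "\<dots> = B * Q" using carr(2) left_mult_one_mat[OF mult_carrier_mat[OF carr(5,7)]] by simp
    finally have eq: "Q * A = B * Q" .
    have "coord (app n a x) l = app n (\<lambda>p q. \<Sum>r<n. Q $$ (p, r) * A $$ (r, q)) x l"
      by (simp add: coord_def app_app a_def)
    also have "\<dots> = app n (\<lambda>p q. \<Sum>r<n. B $$ (p, r) * Q $$ (r, q)) x l"
      unfolding app_def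
    proof (rule sum.cong[OF refl])
      fix q assume "q \<in> {..<n}"
      then have "(\<Sum>r<n. Q $$ (l, r) * A $$ (r, q)) = (\<Sum>r<n. B $$ (l, r) * Q $$ (r, q))"
        using arg_cong[OF eq, of "\<lambda>M. M $$ (l, q)"] that carr(4-7)
        by (simp add: scalar_prod_def atLeast0LessThan)
      then show "(\<Sum>r<n. Q $$ (l, r) * A $$ (r, q)) * x q = (\<Sum>r<n. B $$ (l, r) * Q $$ (r, q)) * x q"
        by simp
    qed
    also have "\<dots> = app n (\<lambda>p q. B $$ (p, q)) (coord x) l"
      by (simp add: coord_def app_app)
    finally show ?thesis by (simp add: app_def)
  qed
  have coord_col: "coord (\<lambda>p. P $$ (p, k)) l = (if l = k then 1 else 0)" if "k < n" "l < n" for k l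
    using arg_cong[OF carr(2), of "\<lambda>M. M $$ (l, k)"] that carr(5-7)
    by (simp add: coord_def app_def scalar_prod_def atLeast0LessThan)
  have coord_inj: "x p = 0" if "\<And>l. l < n \<Longrightarrow> coord x l = 0" "p < n" for x p
  proof -
    have "app n (\<lambda>p q. P $$ (p, q)) (coord x) p = app n (\<lambda>p q. \<Sum>r<n. P $$ (p, r) * Q $$ (r, q)) x p"
      by (simp add: coord_def app_app)
    also have "\<dots> = (\<Sum>q<n. (if p = q then x q else 0))"
      unfolding app_def
    proof (rule sum.cong[OF refl])
      fix q assume "q \<in> {..<n}"
      then show "(\<Sum>r<n. P $$ (p, r) * Q $$ (r, q)) * x q = (if p = q then x q else 0)"
        using arg_cong[OF carr(1), of "\<lambda>M. M $$ (p, q)"] \<open>p < n\<close> carr(5-7)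
        by (simp add: scalar_prod_def atLeast0LessThan)
    qed
    also have "\<dots> = x p" using \<open>p < n\<close> by simp
    finally have "x p = app n (\<lambda>p q. P $$ (p, q)) (coord x) p" by simp
    then show "x p = 0" using that(1) by (simp add: app_def)
  qed
  have main: "k \<le> n \<Longrightarrow> \<exists>w. (\<forall>i<k. \<forall>j<k. dot n (w i) (w j) = (if i = j then 1 else 0)) \<and>
      (\<forall>j<k. flag k (w j)) \<and>
      (\<forall>j<k. \<forall>p<n. app n a (w j) p = ev j * w j p) \<and>
      (\<forall>x. flag k x \<longrightarrow> (\<forall>p<n. x p = (\<Sum>j<k. dot n x (w j) * w j p)))" for k
  proof (induction k)
    case 0
    then show ?case by (auto simp: flag_def intro: coord_inj)
  next
    case (Suc k)
    then obtain w where w: "\<forall>i<k. \<forall>j<k. dot n (w i) (w j) = (if i = j then 1 else 0)"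
        "\<forall>j<k. flag k (w j)" "\<forall>j<k. \<forall>p<n. app n a (w j) p = ev j * w j p"
        "\<forall>x. flag k x \<longrightarrow> (\<forall>p<n. x p = (\<Sum>j<k. dot n x (w j) * w j p))"
      by auto
    have orth: "dot n (w i) (w j) = (if i = j then 1 else 0)" if "i < k" "j < k" for i j
      using w(1) that by blast
    have fl: "flag k (w j)" if "j < k" for j
      using w(2) that by blast
    have eig: "app n a (w j) p = ev j * w j p" if "j < k" "p < n" for j p
      using w(3) that by blast
    have span: "x p = (\<Sum>j<k. dot n x (w j) * w j p)" if "flag k x" "p < n" for x p
      using w(4) that by blast
    have k: "k < n" using Suc.prems by simp
    define c where "c = (\<lambda>p. P $$ (p, k))"
    \<comment> \<open>Gram-Schmidt step; triangularity and self-adjointness make the new vector an eigenvector.\<close>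
    define u where "u = (\<lambda>p. c p - (\<Sum>j<k. dot n c (w j) * w j p))"
    have u_orth: "dot n u (w i) = 0" if "i < k" for i
      using that by (simp add: u_def dot_diff_left dot_sum_left orth if_distrib cong: if_cong)
    have u_orth': "dot n (w i) u = 0" if "i < k" for i
      by (subst dot_commute) (simp add: u_orth that)
    have coord_u: "coord u l = (if l = k then 1 else 0)" if "k \<le> l" "l < n" for l
      using that fl k by (simp add: u_def coord_diff coord_sum c_def coord_col flag_def)
    define r where "r = (\<lambda>p. app n a u p - ev k * u p)"
    have "flag k r"
      unfolding flag_def
    proof (intro allI impI)
      fix l assume l: "k \<le> l" "l < n"
      have "(\<Sum>m<n. B $$ (l, m) * coord u m) = (\<Sum>m<n. if m = k then B $$ (l, k) else 0)"
      proof (intro sum.cong refl)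
        fix m assume "m \<in> {..<n}"
        then show "B $$ (l, m) * coord u m = (if m = k then B $$ (l, k) else 0)"
          using l coord_u[of m] B_tri[of m l] by (cases "m < k") auto
      qed
      also have "\<dots> = B $$ (l, k)" using k by simp
      finally show "coord r l = 0"
        using l coord_u[OF l] B_diag[OF k] B_tri[of k l]
        by (auto simp: r_def coord_diff coord_scale QA)
    qed
    moreover have "dot n r (w j) = 0" if "j < k" for j
    proof -
      have "dot n (app n a u) (w j) = dot n u (\<lambda>p. ev j * w j p)"
        unfolding a_herm by (rule dot_cong) (simp_all add: eig that)
      then show ?thesis
        by (simp add: r_def dot_diff_left dot_scale_left dot_scale_right u_orth that)
    qed
    ultimately have "r p = 0" if "p < n" for p
      using span[of r p] that by simp
    then have eig_u: "app n a u p = ev k * u p" if "p < n" for p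
      using that by (simp add: r_def)
    have "sq_norm n u \<noteq> 0"
    proof
      assume "sq_norm n u = 0"
      then have "coord u k = 0" by (simp add: sq_norm_eq_0_iff coord_def app_def)
      then show False using coord_u[of k] k by simp
    qed
    then have pos: "sq_norm n u > 0" using sq_norm_nonneg[of n u] by linarith
    define s where "s = complex_of_real (1 / sqrt (sq_norm n u))"
    have ss: "s * cnj s * complex_of_real (sq_norm n u) = 1"
      using pos unfolding s_def complex_cnj_complex_of_real of_real_mult[symmetric] by simp
    define w' where "w' j = (if j = k then (\<lambda>p. s * u p) else w j)" for j
    have fl_mono: "flag (Suc k) x" if "flag k x" for x
      using that by (simp add: flag_def)
    have flag_u: "flag (Suc k) (\<lambda>p. s * u p)"
      using coord_u by (simp add: flag_def coord_scale)
    show ?case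
    proof (intro exI[of _ w'] conjI allI impI)
      fix i j assume "i < Suc k" "j < Suc k"
      then show "dot n (w' i) (w' j) = (if i = j then 1 else 0)"
        using orth u_orth u_orth' ss
        by (auto simp: w'_def less_Suc_eq dot_scale_left dot_scale_right dot_self[of n u] mult_ac)
    next
      fix j assume "j < Suc k"
      then show "flag (Suc k) (w' j)"
        using flag_u fl fl_mono by (auto simp: w'_def)
    next
      fix j p assume "j < Suc k" "p < n"
      then show "app n a (w' j) p = ev j * w' j p"
        using eig eig_u by (auto simp: w'_def app_scale)
    next
      fix x p assume x: "flag (Suc k) x" and p: "p < n"
      define y where "y = (\<lambda>p. x p - coord x k * u p)"
      have "flag k y"
        unfolding flag_def
      proof (intro allI impI)
        fix l assume "k \<le> l" "l < n"
        then show "coord y l = 0"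
          using x coord_u[of l] by (cases "l = k") (auto simp: y_def coord_diff coord_scale flag_def)
      qed
      then have "y p = (\<Sum>j<k. dot n y (w j) * w j p)" and y_span: "\<And>p. p < n \<Longrightarrow> y p = (\<Sum>j<k. dot n y (w j) * w j p)"
        using span p by blast+
      moreover have "dot n y (w j) = dot n x (w j)" if "j < k" for j
        using that by (simp add: y_def dot_diff_left dot_scale_left u_orth)
      ultimately have xp: "x p = coord x k * u p + (\<Sum>j<k. dot n x (w j) * w j p)"
        by (simp add: y_def algebra_simps)
      have "dot n y u = dot n (\<lambda>p. \<Sum>j<k. dot n y (w j) * w j p) u"
        by (rule dot_cong) (simp_all add: y_span)
      also have "\<dots> = 0"
        by (simp add: dot_sum_left u_orth')
      finally have "dot n x u = coord x k * complex_of_real (sq_norm n u)"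
        by (simp add: y_def dot_diff_left dot_scale_left dot_self)
      then have "dot n x (\<lambda>p. s * u p) * (s * u p) = coord x k * u p * (s * cnj s * complex_of_real (sq_norm n u))"
        by (simp add: dot_scale_right mult_ac)
      then show "x p = (\<Sum>j<Suc k. dot n x (w' j) * w' j p)"
        using xp ss by (auto simp: w'_def)
    qed
  qed
  obtain w where "\<forall>i<n. \<forall>j<n. dot n (w i) (w j) = (if i = j then 1 else 0)"
      "\<forall>j<n. \<forall>p<n. app n a (w j) p = ev j * w j p"
      "\<forall>x. flag n x \<longrightarrow> (\<forall>p<n. x p = (\<Sum>j<n. dot n x (w j) * w j p))"
    using main[of n] by auto
  then show thesis
    by (intro that[of w]) (auto simp: a_def[abs_def] ev_def flag_def)
qed

lemma sq_norm_eigenbasis: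
  assumes span: "\<And>x p. p < n \<Longrightarrow> x p = (\<Sum>j<n. dot n x (w j) * w j p)"
  shows "sq_norm n x = (\<Sum>j<n. (cmod (dot n x (w j)))\<^sup>2)"
proof -
  have "complex_of_real (sq_norm n x) = dot n (\<lambda>p. \<Sum>j<n. dot n x (w j) * w j p) x"
    unfolding dot_self[symmetric] by (rule dot_cong) (use span in blast)+
  also have "\<dots> = (\<Sum>j<n. dot n x (w j) * cnj (dot n x (w j)))"
    unfolding dot_sum_left using dot_commute[of n _ x] by simp
  finally show ?thesis
    by (simp only: complex_norm_square[symmetric] of_real_sum[symmetric] of_real_power[symmetric] of_real_eq_iff)
qed

lemma quadratic_form_eigenbasis:
  assumes eig: "\<And>j p. j < n \<Longrightarrow> p < n \<Longrightarrow> app n a (w j) p = complex_of_real (e j) * w j p"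
    and span: "\<And>x p. p < n \<Longrightarrow> x p = (\<Sum>j<n. dot n x (w j) * w j p)"
  shows "dot n (app n a x) x = complex_of_real (\<Sum>j<n. e j * (cmod (dot n x (w j)))\<^sup>2)"
proof -
  have "app n a x p = (\<Sum>j<n. (dot n x (w j) * complex_of_real (e j)) * w j p)" if "p < n" for p
  proof -
    have "app n a x = app n a (\<lambda>p. \<Sum>j<n. dot n x (w j) * w j p)"
      by (rule app_cong) (use span in blast)
    then show ?thesis
      using that by (simp add: app_sum eig mult.assoc)
  qed
  then have "dot n (app n a x) x = dot n (\<lambda>p. \<Sum>j<n. (dot n x (w j) * complex_of_real (e j)) * w j p) x"
    by (intro dot_cong) auto
  also have "\<dots> = (\<Sum>j<n. complex_of_real (e j) * (dot n x (w j) * cnj (dot n x (w j))))"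
    unfolding dot_sum_left using dot_commute[of n _ x] by (simp add: mult_ac)
  finally show ?thesis
    by (simp only: complex_norm_square[symmetric] of_real_sum[symmetric] of_real_power[symmetric]
        of_real_mult[symmetric])
qed

text \<open>One half of the Courant-Fischer principle: an \<open>(i+1)\<close>-dimensional space on which the form is at
  least \<open>t\<close> contains a nonzero vector orthogonal to the top \<open>i\<close> eigenvectors, and there the form is at
  most \<open>d (Suc i)\<close>.\<close>

lemma ordered_eigenvalue_ge:
  fixes A :: "complex mat" and u :: "nat \<Rightarrow> nat \<Rightarrow> complex"
  assumes A: "A \<in> carrier_mat n n"
    and herm: "\<And>p q. p < n \<Longrightarrow> q < n \<Longrightarrow> A $$ (p, q) = cnj (A $$ (q, p))"
    and eigvals: "ordered_eigenvalues A d"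
    and i: "i < n"
    and large: "\<And>c x. x = (\<lambda>p. \<Sum>l\<le>i. c l * u l p) \<Longrightarrow>
      t * sq_norm n x \<le> Re (dot n (app n (\<lambda>p q. A $$ (p, q)) x) x)"
    and indep: "\<And>c. (\<And>p. p < n \<Longrightarrow> (\<Sum>l\<le>i. c l * u l p) = 0) \<Longrightarrow> \<forall>l\<le>i. c l = 0"
  shows "t \<le> d (Suc i)"
proof -
  obtain w where orth: "\<And>i j. i < n \<Longrightarrow> j < n \<Longrightarrow> dot n (w i) (w j) = (if i = j then 1 else 0)"
    and eig: "\<And>j p. j < n \<Longrightarrow> p < n \<Longrightarrow> app n (\<lambda>p q. A $$ (p, q)) (w j) p = complex_of_real (d (Suc j)) * w j p"
    and span: "\<And>x p. p < n \<Longrightarrow> x p = (\<Sum>j<n. dot n x (w j) * w j p)"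
    using ordered_eigenbasis[OF A herm eigvals] by blast
  have mono: "d (Suc j) \<le> d (Suc i)" if "i \<le> j" "j < n" for j
    using eigvals that A unfolding ordered_eigenvalues_def monotone_on_def by auto
  obtain c where c: "\<exists>l<Suc i. c l \<noteq> 0" "\<And>j. j < i \<Longrightarrow> (\<Sum>l<Suc i. dot n (u l) (w j) * c l) = 0"
    using homogeneous_system_solution[of i "\<lambda>j l. dot n (u l) (w j)"] by blast
  define x where "x = (\<lambda>p. \<Sum>l\<le>i. c l * u l p)"
  define e where "e j = dot n x (w j)" for j
  have e0: "e j = 0" if "j < i" for j
    using c(2)[OF that] by (simp add: e_def x_def dot_sum_left lessThan_Suc_atMost mult.commute)
  have "sq_norm n x \<noteq> 0"
  proof
    assume "sq_norm n x = 0"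
    then have "\<forall>l\<le>i. c l = 0"
      by (intro indep) (simp add: sq_norm_eq_0_iff x_def)
    then show False using c(1) by (auto simp: less_Suc_eq_le)
  qed
  then have pos: "sq_norm n x > 0" using sq_norm_nonneg[of n x] by linarith
  have form: "dot n (app n (\<lambda>p q. A $$ (p, q)) x) x = complex_of_real (\<Sum>j<n. d (Suc j) * (cmod (e j))\<^sup>2)"
    unfolding e_def by (rule quadratic_form_eigenbasis[OF eig span])
  have norm: "sq_norm n x = (\<Sum>j<n. (cmod (e j))\<^sup>2)"
    unfolding e_def by (rule sq_norm_eigenbasis[OF span])
  have "t * sq_norm n x \<le> (\<Sum>j<n. d (Suc j) * (cmod (e j))\<^sup>2)"
    using large[OF x_def] unfolding form by simp
  also have "\<dots> \<le> (\<Sum>j<n. d (Suc i) * (cmod (e j))\<^sup>2)"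
  proof (rule sum_mono)
    fix j assume "j \<in> {..<n}"
    then show "d (Suc j) * (cmod (e j))\<^sup>2 \<le> d (Suc i) * (cmod (e j))\<^sup>2"
      using mono[of j] e0[of j] by (cases "j < i") (auto intro: mult_right_mono)
  qed
  also have "\<dots> = d (Suc i) * sq_norm n x"
    by (simp add: norm sum_distrib_left)
  finally show ?thesis using pos by simp
qed

text \<open>The other half: the span of the top \<open>i + 1\<close> eigenvectors contains a nonzero vector satisfying
  \<open>i\<close> linear conditions, and there the form is at least \<open>d (Suc i)\<close>.\<close>

lemma ordered_eigenvalue_le:
  fixes A :: "complex mat" and u :: "nat \<Rightarrow> nat \<Rightarrow> complex"
  assumes A: "A \<in> carrier_mat n n"
    and herm: "\<And>p q. p < n \<Longrightarrow> q < n \<Longrightarrow> A $$ (p, q) = cnj (A $$ (q, p))"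
    and eigvals: "ordered_eigenvalues A d"
    and i: "i < n"
    and small: "\<And>x. (\<And>l. l < i \<Longrightarrow> dot n x (u l) = 0) \<Longrightarrow>
      Re (dot n (app n (\<lambda>p q. A $$ (p, q)) x) x) \<le> t * sq_norm n x"
  shows "d (Suc i) \<le> t"
proof -
  obtain w where orth: "\<And>i j. i < n \<Longrightarrow> j < n \<Longrightarrow> dot n (w i) (w j) = (if i = j then 1 else 0)"
    and eig: "\<And>j p. j < n \<Longrightarrow> p < n \<Longrightarrow> app n (\<lambda>p q. A $$ (p, q)) (w j) p = complex_of_real (d (Suc j)) * w j p"
    and span: "\<And>x p. p < n \<Longrightarrow> x p = (\<Sum>j<n. dot n x (w j) * w j p)"
    using ordered_eigenbasis[OF A herm eigvals] by blast
  have mono: "d (Suc i) \<le> d (Suc j)" if "j \<le> i" for j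
    using eigvals that A i unfolding ordered_eigenvalues_def monotone_on_def by auto
  obtain c where c: "\<exists>j<Suc i. c j \<noteq> 0" "\<And>l. l < i \<Longrightarrow> (\<Sum>j<Suc i. dot n (w j) (u l) * c j) = 0"
    using homogeneous_system_solution[of i "\<lambda>l j. dot n (w j) (u l)"] by blast
  define x where "x = (\<lambda>p. \<Sum>j\<le>i. c j * w j p)"
  define e where "e j = dot n x (w j)" for j
  have e: "e j = (if j \<le> i then c j else 0)" if "j < n" for j
    using that i by (simp add: e_def x_def dot_sum_left orth if_distrib cong: if_cong)
  have form: "dot n (app n (\<lambda>p q. A $$ (p, q)) x) x = complex_of_real (\<Sum>j<n. d (Suc j) * (cmod (e j))\<^sup>2)"
    unfolding e_def by (rule quadratic_form_eigenbasis[OF eig span])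
  have norm: "sq_norm n x = (\<Sum>j<n. (cmod (e j))\<^sup>2)"
    unfolding e_def by (rule sq_norm_eigenbasis[OF span])
  obtain l where l: "l \<le> i" "c l \<noteq> 0" using c(1) by (auto simp: less_Suc_eq_le)
  have "0 < (cmod (e l))\<^sup>2" using l e[of l] i by simp
  also have "\<dots> \<le> sq_norm n x"
    unfolding norm using l i by (intro member_le_sum) auto
  finally have pos: "sq_norm n x > 0" .
  have "d (Suc i) * sq_norm n x = (\<Sum>j<n. d (Suc i) * (cmod (e j))\<^sup>2)"
    by (simp add: norm sum_distrib_left)
  also have "\<dots> \<le> (\<Sum>j<n. d (Suc j) * (cmod (e j))\<^sup>2)"
  proof (rule sum_mono)
    fix j assume "j \<in> {..<n}"
    then show "d (Suc i) * (cmod (e j))\<^sup>2 \<le> d (Suc j) * (cmod (e j))\<^sup>2"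
      using mono[of j] e[of j] by (cases "j \<le> i") (auto intro: mult_right_mono)
  qed
  also have "\<dots> \<le> t * sq_norm n x"
    using small[of x] c(2) unfolding form
    by (simp add: x_def dot_sum_left lessThan_Suc_atMost mult.commute)
  finally show ?thesis using pos by simp
qed

section \<open>Almost orthogonal families\<close>

lemma sq_norm_almost_orthogonal:
  fixes u :: "'b \<Rightarrow> nat \<Rightarrow> complex"
  assumes "finite F"
    and diag: "\<And>l. l \<in> F \<Longrightarrow> sq_norm n (u l) = \<nu>"
    and off: "\<And>l m. l \<in> F \<Longrightarrow> m \<in> F \<Longrightarrow> l \<noteq> m \<Longrightarrow> cmod (dot n (u l) (u m)) \<le> b"
    and "b \<ge> 0"
  shows "\<bar>sq_norm n (\<lambda>p. \<Sum>l\<in>F. c l * u l p) - \<nu> * (\<Sum>l\<in>F. (cmod (c l))\<^sup>2)\<bar>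
    \<le> b * real (card F) * (\<Sum>l\<in>F. (cmod (c l))\<^sup>2)"
proof -
  let ?y = "\<lambda>p. \<Sum>l\<in>F. c l * u l p" and ?C = "\<Sum>l\<in>F. (cmod (c l))\<^sup>2"
  define r where "r l m = (if l = m then 0 else c l * (cnj (c m) * dot n (u l) (u m)))" for l m
  have "complex_of_real (sq_norm n ?y) = (\<Sum>l\<in>F. \<Sum>m\<in>F. c l * (cnj (c m) * dot n (u l) (u m)))"
    unfolding dot_self[symmetric] dot_sum_left dot_sum_right by (simp only: sum_distrib_left)
  also have "\<dots> = (\<Sum>l\<in>F. \<Sum>m\<in>F. r l m + (if l = m then complex_of_real (\<nu> * (cmod (c l))\<^sup>2) else 0))"
    by (intro sum.cong refl)
      (auto simp: r_def dot_self diag complex_norm_square mult_ac simp del: of_real_power)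
  also have "\<dots> = (\<Sum>l\<in>F. \<Sum>m\<in>F. r l m) + complex_of_real (\<nu> * ?C)"
    using \<open>finite F\<close> by (simp add: sum.distrib sum_distrib_left)
  finally have diff: "complex_of_real (sq_norm n ?y - \<nu> * ?C) = (\<Sum>l\<in>F. \<Sum>m\<in>F. r l m)"
    by simp
  have "\<bar>sq_norm n ?y - \<nu> * ?C\<bar> = cmod (\<Sum>l\<in>F. \<Sum>m\<in>F. r l m)"
    unfolding diff[symmetric] by (rule norm_of_real[symmetric])
  also have "\<dots> \<le> (\<Sum>l\<in>F. \<Sum>m\<in>F. b * (cmod (c l) * cmod (c m)))"
  proof (intro sum_norm_le)
    fix l m assume "l \<in> F" "m \<in> F"
    then have "l \<noteq> m \<Longrightarrow> cmod (c l) * cmod (c m) * cmod (dot n (u l) (u m)) \<le> cmod (c l) * cmod (c m) * b"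
      by (intro mult_left_mono off) auto
    then show "cmod (r l m) \<le> b * (cmod (c l) * cmod (c m))"
      using \<open>b \<ge> 0\<close> by (auto simp: r_def norm_mult mult_ac)
  qed
  also have "\<dots> = b * (\<Sum>l\<in>F. cmod (c l))\<^sup>2"
    unfolding power2_eq_square sum_product by (simp only: sum_distrib_left)
  also have "\<dots> \<le> b * (?C * real (card F))"
    using \<open>b \<ge> 0\<close> by (intro mult_left_mono sum_squared_le_sum_of_squares) auto
  finally show ?thesis by (simp add: mult_ac)
qed

text \<open>Bessel's inequality by duality: an upper bound for the synthesis map \<open>c \<mapsto> \<Sum>\<^sub>l c\<^sub>l u\<^sub>l\<close> is also one for
  its adjoint \<open>x \<mapsto> (\<langle>x, u\<^sub>l\<rangle>)\<^sub>l\<close>.\<close>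

lemma almost_Bessel:
  fixes u :: "'b \<Rightarrow> nat \<Rightarrow> complex"
  assumes upper: "\<And>c. sq_norm n (\<lambda>p. \<Sum>l\<in>F. c l * u l p) \<le> \<kappa> * (\<Sum>l\<in>F. (cmod (c l))\<^sup>2)"
    and "\<kappa> \<ge> 0"
  shows "(\<Sum>l\<in>F. (cmod (dot n x (u l)))\<^sup>2) \<le> \<kappa> * sq_norm n x"
proof -
  define c where "c l = dot n x (u l)" for l
  define S where "S = (\<Sum>l\<in>F. (cmod (c l))\<^sup>2)"
  have "dot n x (\<lambda>p. \<Sum>l\<in>F. c l * u l p) = complex_of_real S"
    unfolding dot_sum_right S_def c_def[symmetric]
    by (simp add: complex_norm_square mult.commute del: of_real_power)
  then have "S\<^sup>2 \<le> sq_norm n x * sq_norm n (\<lambda>p. \<Sum>l\<in>F. c l * u l p)"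
    using dot_Cauchy_Schwarz[of n x "\<lambda>p. \<Sum>l\<in>F. c l * u l p"] by simp
  also have "\<dots> \<le> sq_norm n x * (\<kappa> * S)"
    unfolding S_def by (intro mult_left_mono upper) simp
  finally have SS: "S * S \<le> (\<kappa> * sq_norm n x) * S"
    by (simp add: power2_eq_square mult_ac)
  have "S \<ge> 0" unfolding S_def by (intro sum_nonneg) simp
  then have "S \<le> \<kappa> * sq_norm n x"
    using SS \<open>\<kappa> \<ge> 0\<close> by (cases "S = 0") auto
  then show ?thesis by (simp add: S_def c_def)
qed

text \<open>On the range of the synthesis map, a lower bound for this map is also one for its adjoint.\<close>

lemma almost_Riesz:
  fixes u :: "'b \<Rightarrow> nat \<Rightarrow> complex"
  assumes lower: "\<kappa> * (\<Sum>l\<in>F. (cmod (c l))\<^sup>2) \<le> sq_norm n (\<lambda>p. \<Sum>l\<in>F. c l * u l p)"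
    and x: "x = (\<lambda>p. \<Sum>l\<in>F. c l * u l p)"
  shows "\<kappa> * sq_norm n x \<le> (\<Sum>l\<in>F. (cmod (dot n x (u l)))\<^sup>2)"
proof (cases "\<kappa> > 0 \<and> sq_norm n x > 0")
  case True
  define C where "C = (\<Sum>l\<in>F. (cmod (c l))\<^sup>2)"
  define S where "S = (\<Sum>l\<in>F. (cmod (dot n x (u l)))\<^sup>2)"
  have "S \<ge> 0" unfolding S_def by (intro sum_nonneg) simp
  have "complex_of_real (sq_norm n x) = (\<Sum>l\<in>F. c l * dot n (u l) x)"
    unfolding dot_self[symmetric] by (subst x) (rule dot_sum_left)
  then have "sq_norm n x = cmod (\<Sum>l\<in>F. c l * dot n (u l) x)"
    by (metis abs_of_nonneg norm_of_real sq_norm_nonneg)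
  also have "\<dots> \<le> (\<Sum>l\<in>F. cmod (c l) * cmod (dot n x (u l)))"
    by (rule sum_norm_le) (simp add: norm_mult, subst dot_commute, simp)
  finally have "(sq_norm n x)\<^sup>2 \<le> (\<Sum>l\<in>F. cmod (c l) * cmod (dot n x (u l)))\<^sup>2"
    by (intro power_mono) auto
  also have "\<dots> \<le> C * S"
    unfolding C_def S_def by (rule Cauchy_Schwarz_ineq_sum)
  finally have "\<kappa> * (sq_norm n x)\<^sup>2 \<le> \<kappa> * (C * S)"
    using True by (intro mult_left_mono) auto
  also have "\<dots> \<le> sq_norm n x * S"
    using mult_right_mono[OF lower \<open>S \<ge> 0\<close>] by (simp add: C_def x mult.assoc)
  finally have "(\<kappa> * sq_norm n x) * sq_norm n x \<le> S * sq_norm n x"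
    by (simp add: power2_eq_square mult_ac)
  then show ?thesis
    using True by (simp add: S_def)
next
  case False
  then have "\<kappa> * sq_norm n x \<le> 0"
    using sq_norm_nonneg[of n x] by (auto simp: not_less intro: mult_nonpos_nonneg)
  also have "\<dots> \<le> (\<Sum>l\<in>F. (cmod (dot n x (u l)))\<^sup>2)"
    by (intro sum_nonneg) simp
  finally show ?thesis .
qed

text \<open>Inner products of distinct unimodular exponentials are geometric sums, bounded independently of
  the length \<open>n\<close>, while each exponential has squared norm \<open>n\<close>. The Gram operator of a finite
  family is thus \<open>n\<close> times the identity up to a bounded error.\<close>

lemma exponentials_almost_orthogonal:
  fixes z :: "'b \<Rightarrow> complex"
  assumes "finite F" and unit: "\<And>l. l \<in> F \<Longrightarrow> cmod (z l) = 1" and inj: "inj_on z F"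
  obtains B where "B \<ge> 0"
    "\<And>n c. \<bar>sq_norm n (\<lambda>p. \<Sum>l\<in>F. c l * z l ^ p) - real n * (\<Sum>l\<in>F. (cmod (c l))\<^sup>2)\<bar>
      \<le> B * (\<Sum>l\<in>F. (cmod (c l))\<^sup>2)"
proof -
  \<comment> \<open>The diagonal terms are \<open>2 / 0 = 0\<close>.\<close>
  define b where "b = (\<Sum>(l, m)\<in>F \<times> F. 2 / cmod (z l - z m))"
  have b: "b \<ge> 0" unfolding b_def by (intro sum_nonneg) auto
  have off: "cmod (dot n (\<lambda>p. z l ^ p) (\<lambda>p. z m ^ p)) \<le> b"
    if lm: "l \<in> F" "m \<in> F" "l \<noteq> m" for l m n
  proof -
    define q where "q = z l * cnj (z m)"
    have zm: "z m * cnj (z m) = 1"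
      using unit[OF lm(2)] complex_norm_square[of "z m"] by simp
    have q1: "cmod (q - 1) = cmod (z l - z m)"
    proof -
      have "q - 1 = (z l - z m) * cnj (z m)"
        using zm by (simp add: q_def algebra_simps)
      then show ?thesis using unit[OF lm(2)] by (simp add: norm_mult)
    qed
    have "z l \<noteq> z m" using inj lm by (auto simp: inj_on_def)
    then have ne: "cmod (z l - z m) > 0" by simp
    then have "q \<noteq> 1" using q1 by auto
    have "dot n (\<lambda>p. z l ^ p) (\<lambda>p. z m ^ p) = (\<Sum>p<n. q ^ p)"
      by (simp add: dot_def q_def power_mult_distrib)
    also have "\<dots> = (q ^ n - 1) / (q - 1)"
      using \<open>q \<noteq> 1\<close> by (rule geometric_sum)
    also have "cmod \<dots> \<le> 2 / cmod (z l - z m)"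
      unfolding norm_divide q1
    proof (rule divide_right_mono)
      have "cmod q = 1" using unit lm by (simp add: q_def norm_mult)
      then show "cmod (q ^ n - 1) \<le> 2"
        using norm_triangle_ineq4[of "q ^ n" 1] by (simp add: norm_power)
    qed simp
    also have "\<dots> \<le> b"
      unfolding b_def
      using member_le_sum[of "(l, m)" "F \<times> F" "\<lambda>(l, m). 2 / cmod (z l - z m)"] lm \<open>finite F\<close> by auto
    finally show ?thesis .
  qed
  have diag: "sq_norm n (\<lambda>p. z l ^ p) = real n" if "l \<in> F" for l n
    using unit[OF that] by (simp add: sq_norm_def norm_power)
  show thesis
    using that[of "b * real (card F)"] b
      sq_norm_almost_orthogonal[OF \<open>finite F\<close> diag off b] by simp
qed

section \<open>The Gram matrices\<close>

lemma gram_mat_quadratic_form: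
  "dot (Suc N) (app (Suc N) (\<lambda>p q. gram_mat K f N $$ (p, q)) x) x
    = complex_of_real ((norm (\<Sum>p<Suc N. cnj (x p) *\<^sub>C (K ^^ p) f))\<^sup>2)"
proof -
  let ?n = "Suc N"
  have "complex_of_real ((norm (\<Sum>p<?n. cnj (x p) *\<^sub>C (K ^^ p) f))\<^sup>2)
      = (\<Sum>p<?n. \<Sum>q<?n. cnj (x p) * (x q * cinner ((K ^^ p) f) ((K ^^ q) f)))"
    by (simp only: cinner_self[symmetric] cinner_sum_sum cinner_scaleC_left cinner_scaleC_right
        complex_cnj_cnj mult_ac)
  also have "\<dots> = (\<Sum>p<?n. (\<Sum>q<?n. gram_mat K f N $$ (p, q) * x q) * cnj (x p))"
    unfolding sum_distrib_right by (intro sum.cong refl) (auto simp: gram_mat_def)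
  finally show ?thesis by (simp only: dot_def app_def)
qed

lemma gram_mat_hermitian:
  assumes "p < Suc N" "q < Suc N"
  shows "gram_mat K f N $$ (p, q) = cnj (gram_mat K f N $$ (q, p))"
  using assms cinner_commute by (simp add: gram_mat_def)

context isometry
begin

lemma eigenvalue_unit:
  assumes "K v = z *\<^sub>C v" "norm v = 1"
  shows "cmod z = 1"
  using assms isometry_norm[of v] by (simp add: norm_scaleC)

lemma iterate_eigenvector: "K v = z *\<^sub>C v \<Longrightarrow> (K ^^ k) v = (z ^ k) *\<^sub>C v"
  by (induction k) (simp_all add: scaleC_one isometry_scaleC scaleC_scaleC)

lemma eigenvectors_orthogonal:
  assumes "K v = z *\<^sub>C v" "K w = y *\<^sub>C w" "cmod z = 1" "cmod y = 1" "z \<noteq> y"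
  shows "cinner v w = 0"
proof -
  have "cinner v w = z * cnj y * cinner v w"
    using isometry_cinner[of v w]
    unfolding assms(1,2) cinner_scaleC_left cinner_scaleC_right mult.assoc by (metis mult.left_commute)
  then have "cinner v w = 0 \<or> z * cnj y = 1" by (simp only: mult_cancel_right1)
  moreover have "z = y" if "z * cnj y = 1"
  proof -
    have "z = z * (y * cnj y)"
      using complex_norm_square[of y] \<open>cmod y = 1\<close> by simp
    also have "\<dots> = z * cnj y * y" by (simp only: mult_ac)
    finally show ?thesis using that by simp
  qed
  ultimately show ?thesis using assms(5) by blast
qed

lemma iterate_orthogonal_eigenvector:
  assumes "K v = z *\<^sub>C v" "cmod z = 1" "cinner h v = 0"
  shows "cinner ((K ^^ k) h) v = 0"
proof -
  have "cnj (z ^ k) * cinner ((K ^^ k) h) v = cinner ((K ^^ k) h) ((K ^^ k) v)"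
    by (simp add: iterate_eigenvector[OF assms(1)] cinner_scaleC_right del: iterate_cinner)
  then have "cnj (z ^ k) * cinner ((K ^^ k) h) v = 0" using assms(3) by simp
  moreover have "z \<noteq> 0" using assms(2) by auto
  ultimately show ?thesis by simp
qed

text \<open>On an eigenvector \<open>v\<^sub>l\<close>, applying \<open>\<Sum>\<^sub>p cnj x\<^sub>p K\<^sup>p\<close> multiplies by the conjugate of \<open>\<langle>x, (z\<^sub>l\<^sup>p)\<^sub>p\<rangle>\<close>, and the orbit of
  \<open>h\<close> stays orthogonal to all the \<open>v\<^sub>l\<close>. The Gram form of \<open>f\<close> is therefore a sum of weighted squares
  of Fourier coefficients of \<open>x\<close> plus the Gram form of \<open>h\<close>.\<close>

lemma norm_orbit_combination_decomposition:
  fixes x :: "nat \<Rightarrow> complex"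
  assumes "finite F"
    and eig: "\<And>l. l \<in> F \<Longrightarrow> K (v l) = z l *\<^sub>C v l"
    and unit: "\<And>l. l \<in> F \<Longrightarrow> cmod (z l) = 1"
    and norm: "\<And>l. l \<in> F \<Longrightarrow> norm (v l) = 1"
    and inj: "inj_on z F"
    and orth: "\<And>l. l \<in> F \<Longrightarrow> cinner h (v l) = 0"
  shows "(norm (\<Sum>p<n. cnj (x p) *\<^sub>C (K ^^ p) ((\<Sum>l\<in>F. a l *\<^sub>C v l) + h)))\<^sup>2
    = (\<Sum>l\<in>F. (cmod (a l))\<^sup>2 * (cmod (dot n x (\<lambda>p. z l ^ p)))\<^sup>2)
      + (norm (\<Sum>p<n. cnj (x p) *\<^sub>C (K ^^ p) h))\<^sup>2"
proof -
  define e where "e l = a l * cnj (dot n x (\<lambda>p. z l ^ p))" for l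
  define y where "y = (\<Sum>p<n. cnj (x p) *\<^sub>C (K ^^ p) h)"
  have "(\<Sum>p<n. cnj (x p) *\<^sub>C (K ^^ p) (\<Sum>l\<in>F. a l *\<^sub>C v l))
      = (\<Sum>p<n. \<Sum>l\<in>F. (cnj (x p) * a l * z l ^ p) *\<^sub>C v l)"
    unfolding iterate_sum iterate_scaleC complex_vector.scale_sum_right
    by (intro sum.cong refl) (simp add: iterate_eigenvector[OF eig] scaleC_scaleC)
  also have "\<dots> = (\<Sum>l\<in>F. e l *\<^sub>C v l)"
    unfolding e_def
    by (subst sum.swap)
      (simp add: dot_def sum_distrib_left mult_ac flip: complex_vector.scale_sum_left)
  finally have "(\<Sum>p<n. cnj (x p) *\<^sub>C (K ^^ p) ((\<Sum>l\<in>F. a l *\<^sub>C v l) + h)) = (\<Sum>l\<in>F. e l *\<^sub>C v l) + y"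
    by (simp add: y_def iterate_add scaleC_add_right sum.distrib)
  moreover have "cinner (\<Sum>l\<in>F. e l *\<^sub>C v l) y = 0"
  proof -
    have "cinner y (v l) = 0" if "l \<in> F" for l
      using that iterate_orthogonal_eigenvector[OF eig unit orth]
      by (simp add: y_def cinner_sum_left cinner_scaleC_left)
    then have "cinner (v l) y = 0" if "l \<in> F" for l
      using that cinner_commute[of "v l" y] by simp
    then show ?thesis by (simp add: cinner_sum_left cinner_scaleC_left)
  qed
  moreover have "(norm (\<Sum>l\<in>F. e l *\<^sub>C v l))\<^sup>2 = (\<Sum>l\<in>F. (cmod (e l))\<^sup>2)"
  proof (subst norm_sum_orthogonal[OF \<open>finite F\<close>])
    fix l m assume lm: "l \<in> F" "m \<in> F" "l \<noteq> m"
    then have "z l \<noteq> z m" using inj by (auto simp: inj_on_def)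
    then show "cinner (e l *\<^sub>C v l) (e m *\<^sub>C v m) = 0"
      using eigenvectors_orthogonal[OF eig eig unit unit, of l m] lm
      by (simp add: cinner_scaleC_left cinner_scaleC_right)
  qed (simp add: norm_scaleC norm)
  ultimately show ?thesis
    by (simp add: norm_add_squared y_def[symmetric] e_def norm_mult power_mult_distrib)
qed

text \<open>Finitely many eigenvectors, among them any prescribed ones, carry \<open>f\<close> up to a remainder \<open>h\<close> whose
  Gram form for large \<open>n\<close> at \<open>x\<close> is at most \<open>\<epsilon> n\<close> times the squared norm of \<open>x\<close>. The remainder is a short tail of the eigenvector series, whose
  rotated orbit means are short at every frequency, plus the part orthogonal to all
  eigenvectors, whose rotated means tend to zero uniformly. Both are treated at once by the
  bound for arbitrary coefficients.\<close>

lemma eigen_decomposition_truncate: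
  assumes dec: "eigen_decomposition K f I z v a g" and "\<epsilon> > 0" and "finite J" "J \<subseteq> I"
  obtains F h n0 where "finite F" "J \<subseteq> F" "F \<subseteq> I"
    "f = (\<Sum>l\<in>F. a l *\<^sub>C v l) + h" "\<And>l. l \<in> F \<Longrightarrow> cinner h (v l) = 0"
    "\<And>n x. n \<ge> n0 \<Longrightarrow> (norm (\<Sum>p<n. cnj (x p) *\<^sub>C (K ^^ p) h))\<^sup>2 \<le> \<epsilon> * real n * sq_norm n x"
proof -
  obtain s where s: "((\<lambda>i. a i *\<^sub>C v i) has_sum s) I" "f = s + g"
    using dec unfolding eigen_decomposition_def by blast
  have eig: "K (v l) = z l *\<^sub>C v l" and nrm: "norm (v l) = 1" and vl: "v l \<in> eigenvectors K" if "l \<in> I" for l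
    using dec that unfolding eigen_decomposition_def is_eigenvector_def eigenvectors_def by auto
  have unit: "cmod (z l) = 1" if "l \<in> I" for l
    by (rule eigenvalue_unit[OF eig[OF that] nrm[OF that]])
  have orth_v: "cinner (v l) (v m) = (if l = m then 1 else 0)" if "l \<in> I" "m \<in> I" for l m
  proof (cases "l = m")
    case True
    then show ?thesis using nrm[OF that(1)] by (simp add: cinner_self)
  next
    case False
    then have "z l \<noteq> z m"
      using dec that unfolding eigen_decomposition_def inj_on_def by blast
    then show ?thesis
      using eigenvectors_orthogonal[OF eig eig unit unit] that False by simp
  qed
  have g_orth: "cinner g w = 0" if "w \<in> eigenvectors K" for w
    using dec that complex_vector.span_base unfolding eigen_decomposition_def by blast
  have approx: "\<exists>F. finite F \<and> J \<subseteq> F \<and> F \<subseteq> I \<and> norm (s - (\<Sum>l\<in>F. a l *\<^sub>C v l)) < \<delta>"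
    if "\<delta> > 0" "finite J" "J \<subseteq> I" for \<delta> J
  proof -
    have "eventually (\<lambda>F. dist (\<Sum>l\<in>F. a l *\<^sub>C v l) s < \<delta>) (finite_subsets_at_top I)"
      using s(1) that(1) unfolding has_sum_def by (rule tendstoD)
    then obtain X where X: "finite X" "X \<subseteq> I"
        "\<forall>Y. finite Y \<and> X \<subseteq> Y \<and> Y \<subseteq> I \<longrightarrow> dist (\<Sum>l\<in>Y. a l *\<^sub>C v l) s < \<delta>"
      by (auto simp only: eventually_finite_subsets_at_top)
    show ?thesis
      using X(3)[rule_format, of "X \<union> J"] X(1,2) that
      by (intro exI[of _ "X \<union> J"]) (auto simp: dist_norm norm_minus_commute)
  qed
  have coeff: "cinner s (v l) = a l" if l: "l \<in> I" for l
  proof -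
    have "cmod (cinner s (v l) - a l) < \<delta>" if \<delta>: "\<delta> > 0" for \<delta>
    proof -
      obtain F where F: "finite F" "{l} \<subseteq> F" "F \<subseteq> I" "norm (s - (\<Sum>l\<in>F. a l *\<^sub>C v l)) < \<delta>"
        using approx[OF \<delta>, of "{l}"] l by auto
      have "cinner (\<Sum>m\<in>F. a m *\<^sub>C v m) (v l) = (\<Sum>m\<in>F. if m = l then a m else 0)"
        unfolding cinner_sum_left cinner_scaleC_left
        using F(3) l by (intro sum.cong refl) (auto simp: orth_v subset_eq)
      also have "\<dots> = a l" using F(1,2) by simp
      finally have "cinner s (v l) - a l = cinner (s - (\<Sum>m\<in>F. a m *\<^sub>C v m)) (v l)"
        by (simp add: cinner_diff_left)
      then show ?thesis
        using cinner_Cauchy_Schwarz[of "s - (\<Sum>m\<in>F. a m *\<^sub>C v m)" "v l"] nrm[OF l] F(4) by simp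
    qed
    then show ?thesis
      using zero_less_norm_iff[of "cinner s (v l) - a l"] by force
  qed
  \<comment> \<open>With this choice the factor \<open>4 \<eta>\<^sup>2\<close> of the bound for arbitrary coefficients equals \<open>\<epsilon>\<close>.\<close>
  define \<eta> where "\<eta> = sqrt \<epsilon> / 2"
  have \<eta>: "\<eta> > 0" "4 * \<eta>\<^sup>2 = \<epsilon>"
    using \<open>\<epsilon> > 0\<close> by (simp_all add: \<eta>_def power_divide)
  obtain F where F: "finite F" "J \<subseteq> F" "F \<subseteq> I" "norm (s - (\<Sum>l\<in>F. a l *\<^sub>C v l)) < \<eta> / 2"
    using approx[of "\<eta> / 2" J] \<eta>(1) assms(3,4) by auto
  define r where "r = s - (\<Sum>l\<in>F. a l *\<^sub>C v l)"
  obtain n0 where n0: "\<And>n c. n \<ge> n0 \<Longrightarrow> cmod c = 1 \<Longrightarrow>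
      norm (\<Sum>k<n. (c ^ k) *\<^sub>C (K ^^ k) g) \<le> \<eta> / 2 * real n"
    using uniform_rotated_orbit_means[of g "\<eta> / 2"] g_orth \<eta>(1) by auto
  show thesis
  proof (rule that[of F "r + g" n0])
    show "finite F" "J \<subseteq> F" "F \<subseteq> I" by (fact F)+
    show "f = (\<Sum>l\<in>F. a l *\<^sub>C v l) + (r + g)" by (simp add: r_def s(2))
  next
    fix l assume l: "l \<in> F"
    then have lI: "l \<in> I" using F(3) by auto
    have "cinner (\<Sum>m\<in>F. a m *\<^sub>C v m) (v l) = (\<Sum>m\<in>F. if m = l then a m else 0)"
      unfolding cinner_sum_left cinner_scaleC_left
      using F(3) lI by (intro sum.cong refl) (auto simp: orth_v subset_eq)
    also have "\<dots> = a l" using F(1) l by simp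
    finally show "cinner (r + g) (v l) = 0"
      using coeff[OF lI] g_orth[OF vl[OF lI]] by (simp add: r_def cinner_add_left cinner_diff_left)
  next
    fix n x assume n: "n \<ge> n0"
    have "norm (\<Sum>k<2*n. (c ^ k) *\<^sub>C (K ^^ k) (r + g)) \<le> \<eta> * real (2 * n)" if c: "cmod c = 1" for c
    proof -
      have "norm (\<Sum>k<2*n. (c ^ k) *\<^sub>C (K ^^ k) r) \<le> (\<Sum>k<2*n. \<eta> / 2)"
        using c F(4) by (intro sum_norm_le) (simp add: norm_scaleC norm_power r_def)
      moreover have "norm (\<Sum>k<2*n. (c ^ k) *\<^sub>C (K ^^ k) g) \<le> \<eta> / 2 * real (2 * n)"
        using n c by (intro n0) auto
      ultimately show ?thesis
        using norm_triangle_ineq[of "\<Sum>k<2*n. (c ^ k) *\<^sub>C (K ^^ k) r" "\<Sum>k<2*n. (c ^ k) *\<^sub>C (K ^^ k) g"]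
        by (simp add: iterate_add scaleC_add_right sum.distrib mult.commute)
    qed
    from norm_orbit_combination_le[OF this, of "\<lambda>p. cnj (x p)"]
    show "(norm (\<Sum>p<n. cnj (x p) *\<^sub>C (K ^^ p) (r + g)))\<^sup>2 \<le> \<epsilon> * real n * sq_norm n x"
      using \<eta> by (simp add: sq_norm_def)
  qed
qed

text \<open>For the upper bound the form is tested on vectors orthogonal to the first \<open>i\<close> exponentials, where
  only weights at most \<open>\<bar>a (Suc i)\<bar>\<^sup>2\<close> survive; for the lower bound it is tested on the span of the
  first \<open>i + 1\<close> exponentials, where all weights are at least \<open>\<bar>a (Suc i)\<bar>\<^sup>2\<close>. If \<open>Suc i\<close> is not an
  index of the decomposition, its coefficient is zero and the lower bound is positivity of
  Gram matrices.\<close>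

lemma gram_mat_eigenvalue_bounds:
  assumes dec: "eigen_decomposition K f I z v a g"
    and decr: "\<And>i j. 1 \<le> i \<Longrightarrow> i \<le> j \<Longrightarrow> cmod (a j) \<le> cmod (a i)"
    and eigvals: "\<And>N. ordered_eigenvalues (gram_mat K f N) (d N)"
    and "\<epsilon> > 0"
  obtains B n0 where "B \<ge> 0"
    "\<And>N. N \<ge> n0 \<Longrightarrow> d N (Suc i) \<le> (cmod (a (Suc i)))\<^sup>2 * (real (Suc N) + B) + \<epsilon> * real (Suc N)"
    "\<And>N. N \<ge> n0 \<Longrightarrow> (cmod (a (Suc i)))\<^sup>2 * (real (Suc N) - B) \<le> d N (Suc i)"
proof -
  have "finite (I \<inter> {1..Suc i})" by simp
  then obtain F h n1 where F: "finite F" "I \<inter> {1..Suc i} \<subseteq> F" "F \<subseteq> I"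
    and f: "f = (\<Sum>l\<in>F. a l *\<^sub>C v l) + h" and h: "\<And>l. l \<in> F \<Longrightarrow> cinner h (v l) = 0"
    and small: "\<And>n x. n \<ge> n1 \<Longrightarrow> (norm (\<Sum>p<n. cnj (x p) *\<^sub>C (K ^^ p) h))\<^sup>2 \<le> \<epsilon> * real n * sq_norm n x"
    using eigen_decomposition_truncate[OF dec \<open>\<epsilon> > 0\<close>, of "I \<inter> {1..Suc i}"] by auto
  have eig: "K (v l) = z l *\<^sub>C v l" and nrm: "norm (v l) = 1" if "l \<in> I" for l
    using dec that unfolding eigen_decomposition_def is_eigenvector_def by auto
  have unit: "cmod (z l) = 1" if "l \<in> I" for l
    by (rule eigenvalue_unit[OF eig[OF that] nrm[OF that]])
  have inj: "inj_on z I" using dec unfolding eigen_decomposition_def by blast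
  have I: "I = {1..} \<or> (\<exists>m. I = {1..m})" using dec unfolding eigen_decomposition_def by blast
  have aI: "a l = 0" if "l \<notin> I" for l using dec that unfolding eigen_decomposition_def by blast
  define T where "T n x l = (cmod (dot n x (\<lambda>p. z l ^ p)))\<^sup>2" for n x l
  have T_nonneg: "T n x l \<ge> 0" for n x l by (simp add: T_def)
  have form: "Re (dot (Suc N) (app (Suc N) (\<lambda>p q. gram_mat K f N $$ (p, q)) x) x)
      = (\<Sum>l\<in>F. (cmod (a l))\<^sup>2 * T (Suc N) x l) + (norm (\<Sum>p<Suc N. cnj (x p) *\<^sub>C (K ^^ p) h))\<^sup>2"
    for N x
  proof -
    have "(norm (\<Sum>p<Suc N. cnj (x p) *\<^sub>C (K ^^ p) f))\<^sup>2
      = (\<Sum>l\<in>F. (cmod (a l))\<^sup>2 * T (Suc N) x l) + (norm (\<Sum>p<Suc N. cnj (x p) *\<^sub>C (K ^^ p) h))\<^sup>2"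
      unfolding T_def f
      by (rule norm_orbit_combination_decomposition)
        (use F eig unit nrm h inj in \<open>auto intro: inj_on_subset\<close>)
    then show ?thesis unfolding gram_mat_quadratic_form by simp
  qed
  have carr: "gram_mat K f N \<in> carrier_mat (Suc N) (Suc N)" for N
    by (simp add: gram_mat_def)
  define b where "b = (cmod (a (Suc i)))\<^sup>2"
  have "b \<ge> 0" by (simp add: b_def)
  define G where "G = {l \<in> F. Suc i \<le> l}"
  have b_ge: "(cmod (a l))\<^sup>2 \<le> b" if "l \<in> G" for l
    using that decr[of "Suc i" l] unfolding b_def G_def by (intro power_mono) auto
  obtain B1 where B1: "B1 \<ge> 0"
    "\<And>n c. \<bar>sq_norm n (\<lambda>p. \<Sum>l\<in>G. c l * z l ^ p) - real n * (\<Sum>l\<in>G. (cmod (c l))\<^sup>2)\<bar>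
      \<le> B1 * (\<Sum>l\<in>G. (cmod (c l))\<^sup>2)"
    by (rule exponentials_almost_orthogonal[of G z])
      (use F unit inj in \<open>auto simp: G_def intro: inj_on_subset\<close>)
  have upper: "d N (Suc i) \<le> b * (real (Suc N) + B1) + \<epsilon> * real (Suc N)" if N: "N \<ge> n1 + i" for N
  proof (rule ordered_eigenvalue_le[where A = "gram_mat K f N" and n = "Suc N"
        and u = "\<lambda>l p. z (Suc l) ^ p", OF carr gram_mat_hermitian eigvals])
    show "i < Suc N" using N by simp
    fix x assume x: "\<And>l. l < i \<Longrightarrow> dot (Suc N) x (\<lambda>p. z (Suc l) ^ p) = 0"
    have T0: "T (Suc N) x l = 0" if "l \<in> F - G" for l
    proof -
      have "l \<ge> 1" "l \<le> i" using that F(3) I by (auto simp: G_def)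
      then show ?thesis using x[of "l - 1"] by (simp add: T_def)
    qed
    have "(\<Sum>l\<in>F. (cmod (a l))\<^sup>2 * T (Suc N) x l) = (\<Sum>l\<in>G. (cmod (a l))\<^sup>2 * T (Suc N) x l)"
      using F(1) T0 by (intro sum.mono_neutral_right) (auto simp: G_def)
    also have "\<dots> \<le> b * (\<Sum>l\<in>G. T (Suc N) x l)"
      unfolding sum_distrib_left by (intro sum_mono mult_right_mono b_ge T_nonneg)
    also have "\<dots> \<le> b * ((real (Suc N) + B1) * sq_norm (Suc N) x)"
      unfolding T_def
    proof (intro mult_left_mono \<open>b \<ge> 0\<close> almost_Bessel)
      show "sq_norm (Suc N) (\<lambda>p. \<Sum>l\<in>G. c l * z l ^ p) \<le> (real (Suc N) + B1) * (\<Sum>l\<in>G. (cmod (c l))\<^sup>2)" for c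
        using B1(2)[of "Suc N" c] by (simp only: ring_distribs abs_le_iff) linarith
      show "0 \<le> real (Suc N) + B1" using B1(1) by simp
    qed
    finally show "Re (dot (Suc N) (app (Suc N) (\<lambda>p q. gram_mat K f N $$ (p, q)) x) x)
        \<le> (b * (real (Suc N) + B1) + \<epsilon> * real (Suc N)) * sq_norm (Suc N) x"
      unfolding form using small[of "Suc N" x] N by (simp add: ring_distribs mult.assoc)
  qed
  show thesis
  proof (cases "Suc i \<in> I")
    case False
    have "0 \<le> d N (Suc i)" if "N \<ge> n1 + i" for N
    \<comment> \<open>The form is nonnegative everywhere, so any independent family serves.\<close>
    proof (rule ordered_eigenvalue_ge[where A = "gram_mat K f N" and n = "Suc N"
        and u = "\<lambda>l p. if p = l then 1 else 0", OF carr gram_mat_hermitian eigvals])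
      show "i < Suc N" using that by simp
      show "0 * sq_norm (Suc N) x \<le> Re (dot (Suc N) (app (Suc N) (\<lambda>p q. gram_mat K f N $$ (p, q)) x) x)" for x
        unfolding gram_mat_quadratic_form by simp
      fix c :: "nat \<Rightarrow> complex"
      assume c: "\<And>p. p < Suc N \<Longrightarrow> (\<Sum>l\<le>i. c l * (if p = l then 1 else 0)) = 0"
      show "\<forall>l\<le>i. c l = 0"
      proof (intro allI impI)
        fix l assume "l \<le> i"
        then show "c l = 0"
          using c[of l] that by (simp add: if_distrib cong: if_cong)
      qed
    qed
    with upper B1(1) show thesis
      using aI[OF False] by (intro that[of B1 "n1 + i"]) (auto simp: b_def)
  next
    case True
    then have E: "{1..Suc i} \<subseteq> I" "{1..Suc i} \<subseteq> F" using I F(2) by auto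
    obtain B2 where B2: "B2 \<ge> 0"
      "\<And>n c. \<bar>sq_norm n (\<lambda>p. \<Sum>l\<in>{..i}. c l * z (Suc l) ^ p) - real n * (\<Sum>l\<in>{..i}. (cmod (c l))\<^sup>2)\<bar>
        \<le> B2 * (\<Sum>l\<in>{..i}. (cmod (c l))\<^sup>2)"
    proof (rule exponentials_almost_orthogonal[of "{..i}" "\<lambda>l. z (Suc l)"])
      show "inj_on (\<lambda>l. z (Suc l)) {..i}"
      proof (rule inj_onI)
        fix l m assume "l \<in> {..i}" "m \<in> {..i}" "z (Suc l) = z (Suc m)"
        then have "Suc l = Suc m" using E(1) by (intro inj_onD[OF inj]) auto
        then show "l = m" by simp
      qed
      show "cmod (z (Suc l)) = 1" if "l \<in> {..i}" for l
        using that E(1) by (intro unit) auto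
    qed auto
    have lower: "b * (real (Suc N) - B2) \<le> d N (Suc i)" if N: "N \<ge> n1 + i + nat \<lceil>B2\<rceil>" for N
    proof (rule ordered_eigenvalue_ge[where A = "gram_mat K f N" and n = "Suc N"
        and u = "\<lambda>l p. z (Suc l) ^ p", OF carr gram_mat_hermitian eigvals])
      have NB: "real (Suc N) > B2" using N by linarith
      have riesz: "(real (Suc N) - B2) * (\<Sum>l\<le>i. (cmod (c l))\<^sup>2) \<le> sq_norm (Suc N) (\<lambda>p. \<Sum>l\<le>i. c l * z (Suc l) ^ p)" for c
        using B2(2)[of "Suc N" c] by (simp only: ring_distribs abs_le_iff left_diff_distrib) linarith
      show "i < Suc N" using N by simp
      show "b * (real (Suc N) - B2) * sq_norm (Suc N) x
          \<le> Re (dot (Suc N) (app (Suc N) (\<lambda>p q. gram_mat K f N $$ (p, q)) x) x)"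
        if x: "x = (\<lambda>p. \<Sum>l\<le>i. c l * z (Suc l) ^ p)" for c x
      proof -
        have "b * ((real (Suc N) - B2) * sq_norm (Suc N) x) \<le> b * (\<Sum>l\<le>i. T (Suc N) x (Suc l))"
          unfolding T_def by (intro mult_left_mono \<open>b \<ge> 0\<close> almost_Riesz[OF riesz x])
        also have "\<dots> = b * (\<Sum>l\<in>{1..Suc i}. T (Suc N) x l)"
          using image_Suc_atMost[of i] sum.reindex[of Suc "{..i}" "T (Suc N) x"]
          by simp
        also have "\<dots> \<le> (\<Sum>l\<in>{1..Suc i}. (cmod (a l))\<^sup>2 * T (Suc N) x l)"
          unfolding sum_distrib_left b_def
          by (intro sum_mono mult_right_mono power_mono decr T_nonneg) auto
        also have "\<dots> \<le> (\<Sum>l\<in>F. (cmod (a l))\<^sup>2 * T (Suc N) x l)"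
          using F(1) E(2) T_nonneg by (intro sum_mono2) auto
        finally show ?thesis unfolding form by (simp add: mult.assoc add_increasing2)
      qed
      fix c :: "nat \<Rightarrow> complex"
      assume c: "\<And>p. p < Suc N \<Longrightarrow> (\<Sum>l\<le>i. c l * z (Suc l) ^ p) = 0"
      have "sq_norm (Suc N) (\<lambda>p. \<Sum>l\<le>i. c l * z (Suc l) ^ p) = 0"
        unfolding sq_norm_eq_0_iff using c by blast
      then have "(\<Sum>l\<le>i. (cmod (c l))\<^sup>2) \<le> 0"
        using riesz[of c] NB by (simp add: mult_le_0_iff)
      then have "(\<Sum>l\<le>i. (cmod (c l))\<^sup>2) = 0"
        by (intro antisym sum_nonneg) auto
      then show "\<forall>l\<le>i. c l = 0"
        by (simp add: sum_nonneg_eq_0_iff)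
    qed
    show thesis
    proof (rule that[of "max B1 B2" "n1 + i + nat \<lceil>B2\<rceil>"])
      show "max B1 B2 \<ge> 0" using B1(1) by simp
      fix N assume N: "N \<ge> n1 + i + nat \<lceil>B2\<rceil>"
      have "b * (real (Suc N) + B1) \<le> b * (real (Suc N) + max B1 B2)"
        and "b * (real (Suc N) - max B1 B2) \<le> b * (real (Suc N) - B2)"
        using \<open>b \<ge> 0\<close> by (auto intro!: mult_left_mono)
      then show "d N (Suc i) \<le> (cmod (a (Suc i)))\<^sup>2 * (real (Suc N) + max B1 B2) + \<epsilon> * real (Suc N)"
        and "(cmod (a (Suc i)))\<^sup>2 * (real (Suc N) - max B1 B2) \<le> d N (Suc i)"
        using upper[of N] lower[OF N] N unfolding b_def by linarith+
    qed
  qed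
qed

end

theorem theorem5:
  fixes K :: "'a::complex_hilbert_space \<Rightarrow> 'a"
    and f f_perp :: 'a
    and I :: "nat set"
    and z a :: "nat \<Rightarrow> complex"
    and v :: "nat \<Rightarrow> 'a"
    and d :: "nat \<Rightarrow> nat \<Rightarrow> real"
  assumes "linear_isometry K"
    and "eigen_decomposition K f I z v a f_perp"
    and "\<And>i j. 1 \<le> i \<Longrightarrow> i \<le> j \<Longrightarrow> cmod (a j) \<le> cmod (a i)"
    and "\<And>N. ordered_eigenvalues (gram_mat K f N) (d N)"
  shows "\<forall>i\<ge>1. (\<lambda>N. d N i / real N) \<longlonglongrightarrow> (cmod (a i))\<^sup>2"
proof (intro allI impI)
  fix i :: nat assume "i \<ge> 1"
  then obtain j where i: "i = Suc j" by (cases i) auto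
  interpret isometry K using assms(1) by unfold_locales
  define b where "b = (cmod (a i))\<^sup>2"
  have bounds: "\<exists>B n0. \<forall>N\<ge>n0. d N i \<le> b * (real (Suc N) + B) + \<epsilon> * real (Suc N)
      \<and> b * (real (Suc N) - B) \<le> d N i" if "\<epsilon> > 0" for \<epsilon>
  proof (rule gram_mat_eigenvalue_bounds[OF assms(2), where d = d and \<epsilon> = \<epsilon> and i = j])
    show "cmod (a l) \<le> cmod (a k)" if "1 \<le> k" "k \<le> l" for k l
      by (rule assms(3)[OF that])
    show "ordered_eigenvalues (gram_mat K f N) (d N)" for N by (rule assms(4))
    show "\<epsilon> > 0" by (rule that)
  qed (auto simp: i b_def)
  have "(\<lambda>N. d N i / real N) \<longlonglongrightarrow> b"
  proof (rule order_tendstoI)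
    fix y assume "y < b"
    obtain B n0 where B: "\<And>N. N \<ge> n0 \<Longrightarrow> b * (real (Suc N) - B) \<le> d N i"
      using bounds[of 1] by auto
    have "(\<lambda>N. b * (1 + (1 - B) * inverse (real N))) \<longlonglongrightarrow> b * (1 + (1 - B) * 0)"
      by (intro tendsto_intros lim_inverse_n)
    then have "eventually (\<lambda>N. y < b * (1 + (1 - B) * inverse (real N))) sequentially"
      using \<open>y < b\<close> by (intro order_tendstoD(1)) simp_all
    with eventually_gt_at_top[of 0] eventually_ge_at_top[of n0]
    show "eventually (\<lambda>N. y < d N i / real N) sequentially"
    proof eventually_elim
      case (elim N)
      have "b * (1 + (1 - B) * inverse (real N)) = b * (real (Suc N) - B) / real N"
        using elim(1) by (simp add: field_simps)
      also have "\<dots> \<le> d N i / real N"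
        by (intro divide_right_mono B elim) simp
      finally show ?case using elim(3) by linarith
    qed
  next
    fix y assume "b < y"
    define \<epsilon> where "\<epsilon> = (y - b) / 2"
    have \<epsilon>: "\<epsilon> > 0" "b + \<epsilon> < y" using \<open>b < y\<close> by (simp_all add: \<epsilon>_def field_simps)
    obtain B n0 where B: "\<And>N. N \<ge> n0 \<Longrightarrow> d N i \<le> b * (real (Suc N) + B) + \<epsilon> * real (Suc N)"
      using bounds[OF \<epsilon>(1)] by blast
    have "(\<lambda>N. b * (1 + (1 + B) * inverse (real N)) + \<epsilon> * (1 + inverse (real N)))
        \<longlonglongrightarrow> b * (1 + (1 + B) * 0) + \<epsilon> * (1 + 0)"
      by (intro tendsto_intros lim_inverse_n)
    then have "eventually (\<lambda>N. b * (1 + (1 + B) * inverse (real N)) + \<epsilon> * (1 + inverse (real N)) < y) sequentially"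
      using \<epsilon>(2) by (intro order_tendstoD(2)) simp_all
    with eventually_gt_at_top[of 0] eventually_ge_at_top[of n0]
    show "eventually (\<lambda>N. d N i / real N < y) sequentially"
    proof eventually_elim
      case (elim N)
      have "d N i / real N \<le> (b * (real (Suc N) + B) + \<epsilon> * real (Suc N)) / real N"
        by (intro divide_right_mono B elim) simp
      also have "\<dots> = b * (1 + (1 + B) * inverse (real N)) + \<epsilon> * (1 + inverse (real N))"
        using elim(1) by (simp add: field_simps)
      finally show ?case using elim(3) by linarith
    qed
  qed
  then show "(\<lambda>N. d N i / real N) \<longlonglongrightarrow> (cmod (a i))\<^sup>2" by (simp add: b_def)
qed

end
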